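(* Let $\alpha>0$, $n\in\mathbb N$, and let $P$ be a polynomial, not identically zero, of degree $d_0$. Then every non-trivial $\alpha$-analytic solution $y$ of the equation $$\mathbb D_\alpha^{n}y+P(x^\alpha)y=0$$ has the form $y(t)=f(t^\alpha)$, $t\ge0$, where $f$ is an entire function whose order equals $\frac1\alpha\left(1+\frac{d_0}{n}\right)$.
   Context: A function $u$ is $\alpha$-analytic (here on $[0,\infty)$) if $u(t)=\sum_{m=0}^\infty u_mt^{\alpha m}$ with the series converging for all $t\ge0$. Non-trivial means not identically zero. $\mathbb D_\alpha$ is the Caputo-Djrbashian fractional derivative of order $\alpha$: for $l-1<\alpha\le l$, $l\in\mathbb N$, $$(\mathbb D_\alpha\varphi)(x)=D^\alpha\Big(\varphi(x)-\sum_{k=0}^{l-1}\frac{\varphi^{(k)}(0)}{k!}x^k\Big),$$ where $D^\alpha\varphi=\frac{d^l}{dx^l}I^{l-\alpha}\varphi$ is the Riemann-Liouville derivative, $I^{\beta}\varphi(x)=\frac1{\Gamma(\beta)}\int_0^x(x-t)^{\beta-1}\varphi(t)\,dt$ for $\beta>0$, and $I^0\varphi=\varphi$. $\mathbb D_\alpha^{j}$ denotes the $j$-th iterate of $\mathbb D_\alpha$. On an $\alpha$-analytic function $u(t)=\sum_{m\ge0}u_mt^{\alpha m}$ it acts termwise: $$(\mathbb D_\alpha^{j}u)(t)=\sum_{m=0}^\infty u_{m+j}\frac{\Gamma((m+j)\alpha+1)}{\Gamma(m\alpha+1)}t^{\alpha m}.$$ The order of a non-constant entire function $f$ is $\limsup_{r\to\infty}\frac{\log\log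 M(r,f)}{\log r}$, where $M(r,f)=\max\{|f(z)|:|z|=r\}$. *)

theory Defs
  imports "HOL-Complex_Analysis.Complex_Analysis"
begin

(* Functions on the half-line [0, oo) are represented by total functions on the reals; only their
   values at nonnegative arguments matter.  Derivatives are taken within [0, oo), hence are
   one-sided at 0; this gives the meaning of the initial values at 0 and of iterates. *)
definition halfline_deriv :: "(real \<Rightarrow> complex) \<Rightarrow> real \<Rightarrow> complex" where
  "halfline_deriv \<phi> x = vector_derivative \<phi> (at x within {0..})"

definition RL_integral :: "real \<Rightarrow> (real \<Rightarrow> complex) \<Rightarrow> real \<Rightarrow> complex" where
  "RL_integral \<beta> \<phi> x =
     (if \<beta> = 0 then \<phi> x
      else (1 / Gamma \<beta>) *\<^sub>R integral {0..x} (\<lambda>t. ((x - t) powr (\<beta> - 1)) *\<^sub>R \<phi> t))"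

(* For \<alpha> > 0, the number l = nat \<lceil>\<alpha>\<rceil> is the natural number with l - 1 < \<alpha> \<le> l. *)
definition RL_deriv :: "real \<Rightarrow> (real \<Rightarrow> complex) \<Rightarrow> real \<Rightarrow> complex" where
  "RL_deriv \<alpha> \<phi> =
     (let l = nat \<lceil>\<alpha>\<rceil> in (halfline_deriv ^^ l) (RL_integral (real l - \<alpha>) \<phi>))"

definition caputo_deriv :: "real \<Rightarrow> (real \<Rightarrow> complex) \<Rightarrow> real \<Rightarrow> complex" where
  "caputo_deriv \<alpha> \<phi> =
     RL_deriv \<alpha> (\<lambda>x. \<phi> x -
       (\<Sum>k<nat \<lceil>\<alpha>\<rceil>. (halfline_deriv ^^ k) \<phi> 0 / fact k * complex_of_real x ^ k))"

(* The power t^(\<alpha> m) is written (t powr \<alpha>) ^ m because 0 powr 0 = 0, which would lose the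
   constant term at t = 0. *)
definition alpha_analytic :: "real \<Rightarrow> (real \<Rightarrow> complex) \<Rightarrow> bool" where
  "alpha_analytic \<alpha> u \<longleftrightarrow>
     (\<exists>c :: nat \<Rightarrow> complex. \<forall>t\<ge>0. (\<lambda>m. c m * complex_of_real ((t powr \<alpha>) ^ m)) sums u t)"

definition max_modulus :: "(complex \<Rightarrow> complex) \<Rightarrow> real \<Rightarrow> real" where
  "max_modulus f r = (SUP z\<in>sphere 0 r. cmod (f z))"

(* Meaningful for non-constant entire f, where max_modulus f r > 1 for all large r. *)
definition entire_order :: "(complex \<Rightarrow> complex) \<Rightarrow> ereal" where
  "entire_order f = Limsup at_top (\<lambda>r. ereal (ln (ln (max_modulus f r)) / ln r))"

end

(* Write y(t) = f(t^alpha) with f(z) = sum c_m z^m.  The Caputo derivative acts termwise on y, so the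
   equation becomes the recurrence
     R_m c_{m+n} + sum_{j <= m} p_j c_{m-j} = 0,  R_m = Gamma(alpha (m+n) + 1) / Gamma(alpha m + 1),
   where p_j are the coefficients of P and R_m has the exact growth m^s with s = alpha n, by
   log-convexity of Gamma.  Put rho = (n + d) / s, where d = deg P.  Solving for the coefficient of
   highest index gives |c_m| <= K A^m (m!)^(-1/rho), hence order <= rho.  If the order were smaller,
   Cauchy's inequality would give |c_m| <= Q^m (m!)^(-tau) with tau > 1/rho; solving for the
   coefficient of lowest index then improves every such bound by a factor 1/2 for large m, so that
   c_m = 0 for large m, and running the recurrence further down makes all c_m vanish. *)
theory Submission
  imports Defs "HOL-Real_Asymp.Real_Asymp"
begin

subsection \<open>Quotients of Gamma values and everywhere convergent power series\<close>

text \<open>The value of \<rho> comes from balancing the two extreme terms of the recurrence, R_m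
  c_{m+n} and p_d c_{m-d}: a jump of n + d indices costs a factor m^(-s), which suggests
  coefficients of size (m!)^(-s/(n+d)), and the series with coefficients (m!)^(-1/\<rho>) has order
  \<rho>. The intermediate terms do no harm to the upper estimate, but they may cancel, so a lower
  bound on a single |c_m| is not readily available. This is why the lower bound on the order is
  obtained by contradiction, from a decay assumption on all large indices at once. The fractional
  calculus has its own obstacle: t^\<alpha> is in general not smooth at 0. The operators are
  therefore applied to whole functions t^s f(t^\<alpha>) with f entire. Power series theory takes
  care of f, and differentiability at 0 is controlled by the exponent s.\<close>

text \<open>For the convex function ln Gamma the slope of the chord over [x, x + s] lies between
  those over [x - 1, x] and [x + s, x + s + 1], and the functional equation makes these two equal to
  ln (x - 1) and ln (x + s). The assumption x > 1 keeps x - 1 in the domain of convexity.\<close>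

lemma Gamma_ratio_bounds:
  fixes x s :: real
  assumes "x > 1" "s > 0"
  shows "(x - 1) powr s \<le> Gamma (x + s) / Gamma x"
    and "Gamma (x + s) / Gamma x \<le> (x + s) powr s"
proof -
  define g where "g = ln \<circ> (Gamma :: real \<Rightarrow> real)"
  have conv: "convex_on {0<..} g"
    unfolding g_def by (rule log_convex_Gamma_real)
  have step: "g (t + 1) - g t = ln t" if "t > 0" for t
  proof -
    have "t \<notin> \<int>\<^sub>\<le>\<^sub>0"
      using that by (auto elim!: nonpos_Ints_cases)
    then show ?thesis
      using that Gamma_plus1[of t] Gamma_real_pos[of t] by (simp add: g_def ln_mult_pos)
  qed
  have diff: "g (x + s) - g x = ln (Gamma (x + s) / Gamma x)"
    using assms by (simp add: g_def ln_div Gamma_real_pos less_imp_neq[THEN not_sym])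
  have pos: "Gamma (x + s) / Gamma x > 0"
    using assms by (simp add: Gamma_real_pos)
  have "(g (x - 1) - g x) / (x - 1 - x) \<le> (g (x - 1) - g (x + s)) / (x - 1 - (x + s))"
    using assms by (intro convex_on_slope_le[OF conv]) auto
  also have "\<dots> \<le> (g x - g (x + s)) / (x - (x + s))"
    using assms by (intro convex_on_slope_le[OF conv]) auto
  finally have "g x - g (x - 1) \<le> (g (x + s) - g x) / s"
    using assms by (simp add: field_simps)
  with step[of "x - 1"] assms have "s * ln (x - 1) \<le> ln (Gamma (x + s) / Gamma x)"
    unfolding diff[symmetric] by (simp add: field_simps)
  then have "exp (s * ln (x - 1)) \<le> exp (ln (Gamma (x + s) / Gamma x))"
    by simp
  then show "(x - 1) powr s \<le> Gamma (x + s) / Gamma x"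
    using pos assms by (simp add: powr_def)
  have "(g x - g (x + s)) / (x - (x + s)) \<le> (g x - g (x + s + 1)) / (x - (x + s + 1))"
    using assms by (intro convex_on_slope_le[OF conv]) auto
  also have "\<dots> \<le> (g (x + s) - g (x + s + 1)) / (x + s - (x + s + 1))"
    using assms by (intro convex_on_slope_le[OF conv]) auto
  finally have "(g (x + s) - g x) / s \<le> g (x + s + 1) - g (x + s)"
    using assms by (simp add: field_simps)
  with step[of "x + s"] assms have "ln (Gamma (x + s) / Gamma x) \<le> s * ln (x + s)"
    unfolding diff[symmetric] by (simp add: field_simps)
  then have "exp (ln (Gamma (x + s) / Gamma x)) \<le> exp (s * ln (x + s))"
    by simp
  then show "Gamma (x + s) / Gamma x \<le> (x + s) powr s"
    using pos assms by (simp add: powr_def)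
qed

section \<open>Entire functions handled through their coefficient sequences\<close>

definition entire_coeffs :: "(nat \<Rightarrow> complex) \<Rightarrow> bool" where
  "entire_coeffs a \<longleftrightarrow> (\<forall>z. summable (\<lambda>m. a m * z ^ m))"

definition entire_fun :: "(nat \<Rightarrow> complex) \<Rightarrow> complex \<Rightarrow> complex" where
  "entire_fun a z = (\<Sum>m. a m * z ^ m)"

lemma entire_coeffs_norm_summable:
  assumes "entire_coeffs a"
  shows "summable (\<lambda>m. norm (a m * z ^ m))"
proof (rule powser_insidea)
  show "summable (\<lambda>n. a n * of_real (norm z + 1) ^ n)"
    using assms by (simp add: entire_coeffs_def)
  have "norm (of_real (norm z + 1) :: complex) = norm z + 1"
    unfolding norm_of_real by simp
  then show "norm z < norm (of_real (norm z + 1) :: complex)"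
    by simp
qed

lemma entire_fun_sums:
  assumes "entire_coeffs a"
  shows "(\<lambda>m. a m * z ^ m) sums entire_fun a z"
  using assms unfolding entire_coeffs_def entire_fun_def by (simp add: summable_sums)

text \<open>\<alpha>-analyticity gives convergence at nonnegative reals only. The point
  \<open>norm z + 1\<close> is one of them, and z lies strictly inside the disc through it.\<close>

lemma entire_coeffs_of_real_nonneg:
  assumes "\<And>r. r \<ge> 0 \<Longrightarrow> summable (\<lambda>m. a m * complex_of_real r ^ m)"
  shows "entire_coeffs a"
  unfolding entire_coeffs_def
proof
  fix z :: complex
  have "norm (of_real (norm z + 1) :: complex) = norm z + 1"
    unfolding norm_of_real by simp
  then have "norm z < norm (of_real (norm z + 1) :: complex)"
    by simp
  with assms[of "norm z + 1"] show "summable (\<lambda>m. a m * z ^ m)"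
    by (rule powser_inside) simp
qed

lemma entire_coeffs_bounded_mult:
  assumes "entire_coeffs a" "\<And>m. norm (k m) \<le> C"
  shows "entire_coeffs (\<lambda>m. k m * a m)"
  unfolding entire_coeffs_def
proof
  fix z :: complex
  have "summable (\<lambda>m. C * norm (a m * z ^ m))"
    by (intro summable_mult entire_coeffs_norm_summable assms)
  moreover have "norm (k m * a m * z ^ m) \<le> C * norm (a m * z ^ m)" for m
    using mult_right_mono[OF assms(2)[of m] norm_ge_zero[of "a m * z ^ m"]]
    by (simp only: norm_mult mult.assoc)
  ultimately show "summable (\<lambda>m. k m * a m * z ^ m)"
    by (rule summable_comparison_test'[where N = 0])
qed

lemma entire_fun_has_field_derivative:
  assumes "entire_coeffs a"
  shows "(entire_fun a has_field_derivative entire_fun (diffs a) z) (at z)"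
  unfolding entire_fun_def
  by (rule termdiffs_strong_converges_everywhere) (use assms in \<open>simp add: entire_coeffs_def\<close>)

lemma entire_coeffs_diffs:
  assumes "entire_coeffs a"
  shows "entire_coeffs (diffs a)"
  using assms termdiff_converges_all[of a] by (simp add: entire_coeffs_def)

lemma entire_fun_holomorphic:
  assumes "entire_coeffs a"
  shows "entire_fun a holomorphic_on A"
proof (rule holomorphic_on_subset)
  show "entire_fun a holomorphic_on UNIV"
    using entire_fun_has_field_derivative[OF assms] by (auto simp: holomorphic_on_open)
qed simp

lemma entire_coeffs_Suc:
  assumes "entire_coeffs a"
  shows "entire_coeffs (\<lambda>m. a (Suc m))"
    and "entire_fun a z = a 0 + z * entire_fun (\<lambda>m. a (Suc m)) z"
proof -
  have S: "summable (\<lambda>m. a m * z ^ m)" for z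
    using assms by (simp add: entire_coeffs_def)
  show "entire_coeffs (\<lambda>m. a (Suc m))"
    unfolding entire_coeffs_def using powser_split_head(3)[OF S] by simp
  show "entire_fun a z = a 0 + z * entire_fun (\<lambda>m. a (Suc m)) z"
    unfolding entire_fun_def using powser_split_head(1)[OF S] by (simp add: mult.commute)
qed

text \<open>The multiplier s + k m represents the operator s + k z d/dz. With k = \<alpha> this is
  what differentiating t^s f(t^\<alpha>) does to f, apart from lowering s by one.\<close>

lemma entire_fun_affine_mult:
  fixes s k :: complex
  assumes "entire_coeffs a"
  shows "entire_coeffs (\<lambda>m. (s + k * of_nat m) * a m)"
    and "entire_fun (\<lambda>m. (s + k * of_nat m) * a m) z =
         s * entire_fun a z + k * z * entire_fun (diffs a) z"
proof -
  have *: "(\<lambda>m. (s + k * of_nat m) * a m * z ^ m) sums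
         (s * entire_fun a z + k * z * entire_fun (diffs a) z)" for z
  proof -
    have "(\<lambda>m. of_nat (Suc m) * a (Suc m) * z ^ m) sums entire_fun (diffs a) z"
      using entire_fun_sums[OF entire_coeffs_diffs[OF assms]] by (simp add: diffs_def)
    from sums_mult[OF this, of z]
    have "(\<lambda>m. of_nat (Suc m) * a (Suc m) * z ^ Suc m) sums (z * entire_fun (diffs a) z)"
      by (simp add: mult_ac)
    then have "(\<lambda>m. of_nat m * a m * z ^ m) sums (z * entire_fun (diffs a) z)"
      by (subst (asm) sums_Suc_iff) simp
    from sums_add[OF sums_mult[OF entire_fun_sums[OF assms], of s] sums_mult[OF this, of k]]
    show ?thesis by (simp add: algebra_simps)
  qed
  from * show "entire_coeffs (\<lambda>m. (s + k * of_nat m) * a m)"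
    unfolding entire_coeffs_def using sums_summable[OF *] by simp
  from * show "entire_fun (\<lambda>m. (s + k * of_nat m) * a m) z =
         s * entire_fun a z + k * z * entire_fun (diffs a) z"
    unfolding entire_fun_def[of "\<lambda>m. (s + k * of_nat m) * a m"] by (rule sums_unique[symmetric])
qed

text \<open>The fractional equation holds on [0, oo) only. Since 0 is a limit point of this ray, the
  identity theorem makes the function vanish everywhere, whereas a nonzero coefficient would isolate
  the zero at 0. This turns the equation into relations between coefficients.\<close>

lemma entire_coeffs_unique:
  assumes "entire_coeffs a" and "\<And>x. x \<ge> 0 \<Longrightarrow> entire_fun a (complex_of_real x) = 0"
  shows "a m = 0"
proof -
  have zero: "entire_fun a z = 0" for z
  proof (rule analytic_continuation[where f = "entire_fun a" and S = UNIV and \<xi> = 0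
      and U = "complex_of_real ` {0..}"])
    have "0 islimpt complex_of_real ` {0..}"
      unfolding islimpt_approachable
    proof safe
      fix e :: real assume "e > 0"
      then show "\<exists>x'\<in>complex_of_real ` {0..}. x' \<noteq> 0 \<and> dist x' 0 < e"
        by (intro bexI[of _ "of_real (e / 2)"] imageI) auto
    qed
    then show "0 islimpt complex_of_real ` {0..}" .
  qed (use assms in \<open>auto simp: entire_fun_holomorphic\<close>)
  show ?thesis
  proof (rule ccontr)
    assume "a m \<noteq> 0"
    moreover have "a 0 = 0"
      using entire_fun_sums[OF assms(1), of 0] zero[of 0] by simp
    ultimately have "m > 0" by (cases m) auto
    from assms(1) have "(\<lambda>n. a n * (x - 0) ^ n) sums entire_fun a x" for x
      using entire_fun_sums by simp
    then obtain s where s: "0 < s" "\<And>z. z \<in> cball 0 s - {0} \<Longrightarrow> entire_fun a z \<noteq> 0"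
      using powser_0_nonzero[of 1 0 a "entire_fun a" m] zero \<open>a m \<noteq> 0\<close> \<open>m > 0\<close>
      by (metis zero_less_one)
    from s(1) have "complex_of_real s \<in> cball 0 s - {0}"
      by simp
    with s(2) zero show False
      by blast
  qed
qed

subsection \<open>Growth of entire functions and decay of their coefficients\<close>

text \<open>This bound on a quotient of factorials and the opposite one below convert index shifts
  into powers: this one for the forward induction and the Cauchy estimate, the other for the
  backward recurrence.\<close>

lemma fact_le_power_mult_fact:
  assumes "k \<le> m"
  shows "(fact m :: real) \<le> real m ^ k * fact (m - k)"
proof -
  have "fact m = fact m div fact (m - k) * (fact (m - k) :: nat)"
    by (simp add: fact_dvd)
  also have "\<dots> \<le> m ^ k * fact (m - k)"
    by (intro mult_right_mono fact_div_fact_le_pow assms) auto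
  finally have "real (fact m) \<le> real (m ^ k * fact (m - k))"
    by (rule of_nat_mono)
  then show ?thesis by simp
qed

lemma power_mult_fact_le_fact:
  "real (k + 1) ^ i * fact k \<le> fact (k + i)"
proof (induction i)
  case (Suc i)
  have "real (k + 1) ^ Suc i * fact k \<le> real (k + 1) * fact (k + i)"
    using Suc mult_left_mono[OF Suc, of "real (k + 1)"] by (simp add: mult_ac)
  also have "\<dots> \<le> real (k + i + 1) * fact (k + i)"
    by (intro mult_right_mono) auto
  finally show ?case by (simp add: algebra_simps)
qed simp

lemma power_div_fact_le_exp:
  fixes x :: real
  assumes "x \<ge> 0"
  shows "x ^ m / fact m \<le> exp x"
proof -
  have "(\<lambda>n. x ^ n / fact n) sums exp x"
    using exp_converges[of x] by (simp add: field_simps)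
  then show ?thesis
    using sum_le_suminf[of "\<lambda>n. x ^ n / fact n" "{m}"] assms by (simp add: sums_iff)
qed

text \<open>Apply y^m / m! <= exp y to y = x^\<rho> and raise to the power 1/\<rho>: this bounds x^m
  (m!)^(-1/\<rho>) by a quantity independent of m.\<close>

lemma entire_fun_growth_le:
  assumes ent: "entire_coeffs c" and "\<rho> > 0" "A > 0" "K \<ge> 0" "z \<noteq> 0"
    and c: "\<And>m. norm (c m) \<le> K * A ^ m * fact m powr (- 1 / \<rho>)"
  shows "norm (entire_fun c z) \<le> 2 * K * exp ((2 * A) powr \<rho> / \<rho> * norm z powr \<rho>)"
proof -
  \<comment> \<open>The factor 2 only worsens the constant in the exponent, but it leaves (1/2)^m in
    each term, so that a geometric series with sum 2 dominates.\<close>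
  define x where "x = 2 * A * norm z"
  define E where "E = exp (x powr \<rho> / \<rho>)"
  have "x > 0" using assms by (simp add: x_def)
  have *: "norm (c m * z ^ m) \<le> K * E * (1 / 2) ^ m" for m
  proof -
    have "((x powr \<rho>) ^ m / fact m) powr (1 / \<rho>) \<le> exp (x powr \<rho>) powr (1 / \<rho>)"
      using assms by (intro powr_mono2 power_div_fact_le_exp) auto
    also have "exp (x powr \<rho>) powr (1 / \<rho>) = E"
      by (simp add: E_def powr_def)
    also have "((x powr \<rho>) ^ m / fact m) powr (1 / \<rho>) = x ^ m * fact m powr (- 1 / \<rho>)"
    proof -
      have "((x powr \<rho>) ^ m) powr (1 / \<rho>) = x powr (real m)"
        using \<open>x > 0\<close> \<open>\<rho> > 0\<close> by (simp add: powr_powr powr_power)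
      then show ?thesis
        using \<open>x > 0\<close> by (simp add: powr_divide powr_realpow powr_minus_divide)
    qed
    finally have E: "x ^ m * fact m powr (- 1 / \<rho>) \<le> E" .
    have "norm (c m * z ^ m) \<le> K * A ^ m * fact m powr (- 1 / \<rho>) * norm z ^ m"
      unfolding norm_mult norm_power by (intro mult_right_mono c) auto
    also have "\<dots> = K * (1 / 2) ^ m * (x ^ m * fact m powr (- 1 / \<rho>))"
      by (simp add: x_def power_mult_distrib power_divide)
    also have "\<dots> \<le> K * (1 / 2) ^ m * E"
      using assms by (intro mult_left_mono E) auto
    finally show ?thesis by (simp add: mult_ac)
  qed
  have "norm (entire_fun c z) \<le> (\<Sum>m. K * E * (1 / 2) ^ m)"
    unfolding entire_fun_def
    by (rule norm_suminf_le[OF *]) (intro summable_mult summable_geometric, simp)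
  also have "\<dots> = 2 * K * E"
    by (subst suminf_mult) (simp_all add: summable_geometric suminf_geometric)
  also have "E = exp ((2 * A) powr \<rho> / \<rho> * norm z powr \<rho>)"
    using assms by (simp add: E_def x_def powr_mult)
  finally show ?thesis .
qed

section \<open>Maximum modulus and order\<close>

lemma norm_le_max_modulus:
  assumes "f holomorphic_on UNIV" "norm z = r"
  shows "norm (f z) \<le> max_modulus f r"
  unfolding max_modulus_def
proof (rule cSUP_upper)
  have "continuous_on (sphere 0 r) f"
    using assms(1) holomorphic_on_imp_continuous_on holomorphic_on_subset by blast
  then have "compact ((\<lambda>z. norm (f z)) ` sphere 0 r)"
    by (intro compact_continuous_image continuous_on_norm) auto
  then show "bdd_above ((\<lambda>z. norm (f z)) ` sphere 0 r)"
    by (intro bounded_imp_bdd_above compact_imp_bounded)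
qed (use assms in auto)

lemma max_modulus_le:
  assumes "r > 0" "\<And>z. norm z = r \<Longrightarrow> norm (f z) \<le> B"
  shows "max_modulus f r \<le> B"
  unfolding max_modulus_def
proof (rule cSUP_least)
  have "complex_of_real r \<in> sphere 0 r" using assms by simp
  then show "sphere (0 :: complex) r \<noteq> {}" by blast
qed (use assms in auto)

lemma entire_coeff_le_max_modulus:
  assumes "entire_coeffs c" "r > 0"
  shows "norm (c m) * r ^ m \<le> max_modulus (entire_fun c) r"
proof -
  let ?f = "entire_fun c"
  have holo: "?f holomorphic_on A" for A
    by (rule entire_fun_holomorphic[OF assms(1)])
  have "?f has_fps_expansion Abs_fps c"
    unfolding has_fps_expansion_def
  proof
    have "conv_radius c = \<infinity>"
      using assms(1) unfolding entire_coeffs_def by (intro conv_radius_inftyI'') simp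
    then show "fps_conv_radius (Abs_fps c) > 0"
      by (simp add: fps_conv_radius_def)
    show "\<forall>\<^sub>F z in nhds 0. eval_fps (Abs_fps c) z = ?f z"
      by (simp add: eval_fps_def entire_fun_def)
  qed
  from fps_nth_fps_expansion[OF this, of m]
  have deriv: "(deriv ^^ m) ?f 0 = fact m * c m"
    by simp
  have "norm ((deriv ^^ m) ?f 0) \<le> fact m * max_modulus ?f r / r ^ m"
  proof (rule Cauchy_inequality)
    show "continuous_on (cball 0 r) ?f"
      by (rule holomorphic_on_imp_continuous_on[OF holo])
    show "norm (?f z) \<le> max_modulus ?f r" if "norm (0 - z) = r" for z
      using that by (intro norm_le_max_modulus holo) simp
  qed (simp_all add: holo assms)
  then have "fact m * norm (c m) \<le> fact m * (max_modulus ?f r / r ^ m)"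
    by (simp add: deriv norm_mult)
  then have "norm (c m) \<le> max_modulus ?f r / r ^ m"
    by (subst (asm) mult_le_cancel_left_pos) auto
  with assms show ?thesis by (simp add: field_simps)
qed

text \<open>Two logarithms turn the bound into ln (ln K + D r^\<rho>) / ln r, which tends to \<rho>.
  The hypothesis \<open>large\<close> makes the argument of the outer logarithm positive, where
  \<open>ln\<close> is monotone.\<close>

lemma entire_order_leI:
  assumes "\<rho> > 0" "K > 0" "D > 0"
    and bound: "\<And>z. z \<noteq> 0 \<Longrightarrow> norm (f z) \<le> K * exp (D * norm z powr \<rho>)"
    and large: "\<forall>\<^sub>F r in at_top. max_modulus f r > exp 1"
  shows "entire_order f \<le> ereal \<rho>"
proof -
  have "((\<lambda>r. ln (ln K + D * r powr \<rho>) / ln r) \<longlongrightarrow> \<rho>) at_top"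
    using assms(1-3) by real_asymp
  then have lim: "Limsup at_top (\<lambda>r. ereal (ln (ln K + D * r powr \<rho>) / ln r)) = ereal \<rho>"
    by (intro lim_imp_Limsup) auto
  have "\<forall>\<^sub>F r in at_top. ereal (ln (ln (max_modulus f r)) / ln r) \<le>
          ereal (ln (ln K + D * r powr \<rho>) / ln r)"
    using large eventually_gt_at_top[of 1]
  proof eventually_elim
    case (elim r)
    have "max_modulus f r \<le> K * exp (D * r powr \<rho>)"
    proof (rule max_modulus_le)
      show "norm (f z) \<le> K * exp (D * r powr \<rho>)" if "norm z = r" for z
        using bound[of z] that elim by (cases "z = 0") simp_all
    qed (use elim in simp)
    moreover have M: "max_modulus f r > 0"
      using elim(1) by (rule less_trans[OF exp_gt_zero])
    ultimately have "ln (max_modulus f r) \<le> ln (K * exp (D * r powr \<rho>))"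
      by (intro ln_mono) auto
    also have "\<dots> = ln K + D * r powr \<rho>"
      using assms by (simp add: ln_mult_pos)
    finally have 1: "ln (max_modulus f r) \<le> ln K + D * r powr \<rho>" .
    have "ln (exp 1) < ln (max_modulus f r)"
      using elim M by (intro ln_less_cancel_iff[THEN iffD2]) auto
    then have "ln (max_modulus f r) > 0" by simp
    with 1 have "ln (ln (max_modulus f r)) \<le> ln (ln K + D * r powr \<rho>)"
      by (intro ln_mono) auto
    with elim show ?case by (simp add: divide_right_mono)
  qed
  from Limsup_mono[OF this] show ?thesis
    unfolding entire_order_def lim .
qed

lemma entire_order_lessD:
  assumes "entire_order f < ereal \<rho>" "\<rho> > 0"
  obtains \<sigma> where "0 < \<sigma>" "\<sigma> < \<rho>" "\<forall>\<^sub>F r in at_top. max_modulus f r \<le> exp (r powr \<sigma>)"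
proof -
  obtain q where q: "entire_order f < ereal q" "ereal q < ereal \<rho>"
    using assms(1) ereal_dense2 by blast
  \<comment> \<open>The number q between the order and \<rho> may be negative or 0; the maximum with
    \<rho> / 2 makes the exponent positive and keeps it below \<rho>.\<close>
  define \<sigma> where "\<sigma> = max q (\<rho> / 2)"
  have \<sigma>: "0 < \<sigma>" "\<sigma> < \<rho>" "q \<le> \<sigma>"
    using q assms by (auto simp: \<sigma>_def)
  have "Limsup at_top (\<lambda>r. ereal (ln (ln (max_modulus f r)) / ln r)) < ereal \<sigma>"
    using q(1) \<sigma>(3) unfolding entire_order_def by (meson ereal_less_eq(3) less_le_trans)
  then have "\<forall>\<^sub>F r in at_top. ereal (ln (ln (max_modulus f r)) / ln r) < ereal \<sigma>"
    by (rule Limsup_lessD)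
  then have "\<forall>\<^sub>F r in at_top. max_modulus f r \<le> exp (r powr \<sigma>)"
    using eventually_gt_at_top[of 1]
  proof eventually_elim
    case (elim r)
    have pow: "1 \<le> r powr \<sigma>"
      using elim \<sigma> by (intro ge_one_powr_ge_zero) auto
    show ?case
    proof (cases "max_modulus f r \<le> exp 1")
      case True
      also have "exp 1 \<le> exp (r powr \<sigma>)" using pow by simp
      finally show ?thesis .
    next
      case False
      then have M: "max_modulus f r > 0" "exp 1 < max_modulus f r"
        using less_trans[OF exp_gt_zero[of "1::real"], of "max_modulus f r"] by auto
      then have "ln (exp 1) < ln (max_modulus f r)"
        by (intro ln_less_cancel_iff[THEN iffD2]) auto
      then have L: "ln (max_modulus f r) > 0" by simp
      have "ln (ln (max_modulus f r)) < \<sigma> * ln r"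
        using elim by (simp add: field_simps)
      then have "exp (ln (ln (max_modulus f r))) < exp (\<sigma> * ln r)"
        by simp
      then have "ln (max_modulus f r) < r powr \<sigma>"
        using L elim by (simp add: powr_def)
      then have "exp (ln (max_modulus f r)) < exp (r powr \<sigma>)"
        by simp
      with M show ?thesis by simp
    qed
  qed
  with \<sigma> that show thesis by blast
qed

text \<open>Cauchy's inequality is taken at radius r = m^(1/\<sigma>), up to a constant factor the
  one minimising exp (r^\<sigma>) / r^m. There the numerator is e^m, and r^m = (m^m)^(1/\<sigma>) >=
  (m!)^(1/\<sigma>).\<close>

lemma entire_coeffs_decay:
  assumes "entire_coeffs c" "\<sigma> > 0"
    and "\<forall>\<^sub>F r in at_top. max_modulus (entire_fun c) r \<le> exp (r powr \<sigma>)"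
  shows "\<forall>\<^sub>F m in sequentially. norm (c m) \<le> exp 1 ^ m * fact m powr (- 1 / \<sigma>)"
proof -
  have "filterlim (\<lambda>m::nat. real m powr (1 / \<sigma>)) at_top sequentially"
    using assms(2) by real_asymp
  from eventually_compose_filterlim[OF assms(3) this] eventually_gt_at_top[of 0]
  show ?thesis
  proof eventually_elim
    case (elim m)
    define r where "r = real m powr (1 / \<sigma>)"
    have r: "r > 0" "r powr \<sigma> = real m"
      using elim assms by (auto simp: r_def powr_powr)
    have "fact m \<le> real m ^ m"
      using fact_le_power_mult_fact[of m m] by simp
    then have "fact m powr (1 / \<sigma>) \<le> (real m ^ m) powr (1 / \<sigma>)"
      using assms by (intro powr_mono2) auto
    also have "\<dots> = r ^ m"
      using elim by (simp add: r_def powr_powr powr_realpow[symmetric] mult.commute)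
    finally have "norm (c m) * fact m powr (1 / \<sigma>) \<le> norm (c m) * r ^ m"
      by (intro mult_left_mono) auto
    also have "\<dots> \<le> exp (real m)"
      using entire_coeff_le_max_modulus[OF assms(1) r(1), of m] elim r by (simp add: r_def)
    also have "\<dots> = exp 1 ^ m"
      by (simp add: exp_of_nat_mult[symmetric])
    finally show ?case
      by (simp add: powr_minus field_simps)
  qed
qed

subsection \<open>Coefficients satisfying the recurrence\<close>

text \<open>In the equation for c_M the other indices are lower by n + j <= n + d, so the factorials
  lose at most a factor M^(n+d). With \<tau> = s / (n + d) this loss becomes M^s, which the lower
  bound on R cancels exactly; the bound therefore reproduces itself by induction.\<close>

lemma recurrence_coeffs_upper:
  fixes c p :: "nat \<Rightarrow> complex" and R :: "nat \<Rightarrow> real"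
  assumes rec: "\<And>m. of_real (R m) * c (m + n) + (\<Sum>j\<le>m. p j * c (m - j)) = 0"
    and p: "\<And>j. j > d \<Longrightarrow> p j = 0"
    and R: "\<And>m. R m \<ge> b * real (m + n) powr s"
    and "b > 0" "s > 0" "n \<ge> 1"
  obtains K A where "K > 0" "A > 0" "\<And>m. norm (c m) \<le> K * A ^ m * fact m powr (- s / real (n + d))"
proof -
  have p': "j \<le> d" if "p j \<noteq> 0" for j
    using p that not_le by blast
  define \<tau> where "\<tau> = s / real (n + d)"
  define S where "S = (\<Sum>j\<le>d. norm (p j))"
  \<comment> \<open>A >= S / b absorbs the coefficients of P divided by the constant in the bound on
    R, and A >= 1 allows exponents of A to be increased. K covers the coefficients of index below n,
    which the recurrence leaves free.\<close>
  define A where "A = max 1 (S / b)"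
  define K where "K = 1 + (\<Sum>m<n. norm (c m) * fact m powr \<tau>)"
  have \<tau>: "\<tau> > 0" using assms by (simp add: \<tau>_def)
  have A: "A \<ge> 1" "S / b \<le> A" by (simp_all add: A_def)
  have K: "K \<ge> 1" unfolding K_def by (simp add: sum_nonneg)
  have bound: "norm (c M) \<le> K * A ^ M * fact M powr - \<tau>" for M
  proof (induction M rule: less_induct)
    case (less M)
    show ?case
    proof (cases "M < n")
      case True
      have "norm (c M) * fact M powr \<tau> \<le> (\<Sum>m<n. norm (c m) * fact m powr \<tau>)"
        using True by (intro member_le_sum) auto
      also have "\<dots> \<le> K" by (simp add: K_def)
      also have "K \<le> K * A ^ M" using K A by simp
      finally show ?thesis by (simp add: powr_minus field_simps)
    next
      case False
      define m where "m = M - n"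
      have M: "M = m + n" using False by (simp add: m_def)
      have "M \<ge> 1" using M \<open>n \<ge> 1\<close> by simp
      define X where "X = K * A ^ m * fact M powr - \<tau> * real M powr s"
      have X: "X \<ge> 0" using K A by (simp add: X_def)
      have term_le: "norm (p j * c (m - j)) \<le> norm (p j) * X" if "j \<le> m" for j
      proof (cases "j > d")
        case True
        then show ?thesis by (simp add: p)
      next
        case False
        have eq: "M - (n + j) = m - j" "n + j \<le> M" using M that by auto
        have "norm (c (m - j)) \<le> K * A ^ (m - j) * fact (m - j) powr - \<tau>"
          using M \<open>n \<ge> 1\<close> by (intro less) auto
        also have "\<dots> \<le> K * A ^ m * (fact M powr - \<tau> * real M powr s)"
        proof (intro mult_mono mult_left_mono power_increasing)
          have "fact M powr \<tau> \<le> (real M ^ (n + j) * fact (m - j)) powr \<tau>"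
            using \<tau> fact_le_power_mult_fact[OF eq(2)] eq(1) by (intro powr_mono2) auto
          also have "\<dots> = real M powr (real (n + j) * \<tau>) * fact (m - j) powr \<tau>"
            using \<open>M \<ge> 1\<close> by (simp add: powr_mult powr_powr powr_realpow[symmetric])
          also have "\<dots> \<le> real M powr s * fact (m - j) powr \<tau>"
          proof (intro mult_right_mono powr_mono)
            have "real (n + j) * \<tau> \<le> real (n + d) * \<tau>"
              using \<tau> False by (intro mult_right_mono) auto
            also have "\<dots> = s" using \<open>n \<ge> 1\<close> by (simp add: \<tau>_def)
            finally show "real (n + j) * \<tau> \<le> s" .
          qed (use \<open>M \<ge> 1\<close> in auto)
          finally show "fact (m - j) powr - \<tau> \<le> fact M powr - \<tau> * real M powr s"
            by (simp add: powr_minus field_simps)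
        qed (use K A in auto)
        finally have "norm (c (m - j)) \<le> X" by (simp add: X_def mult_ac)
        then show ?thesis by (simp add: norm_mult mult_left_mono)
      qed
      have sum_le: "(\<Sum>j\<le>m. norm (p j)) \<le> S"
      proof -
        have "(\<Sum>j\<le>m. norm (p j)) = (\<Sum>j\<in>{..m} \<inter> {..d}. norm (p j))"
          by (rule sum.mono_neutral_right) (auto dest: p')
        also have "\<dots> \<le> S" unfolding S_def by (rule sum_mono2) auto
        finally show ?thesis .
      qed
      have "b * real M powr s * norm (c M) \<le> \<bar>R m\<bar> * norm (c M)"
        using R[of m] M by (intro mult_right_mono) auto
      also have "\<dots> = norm (\<Sum>j\<le>m. p j * c (m - j))"
      proof -
        have "of_real (R m) * c (m + n) = - (\<Sum>j\<le>m. p j * c (m - j))"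
          using rec[of m] by (simp add: eq_neg_iff_add_eq_0)
        from arg_cong[OF this, of norm] show ?thesis
          using M by (simp only: norm_mult norm_of_real norm_minus_cancel)
      qed
      also have "\<dots> \<le> (\<Sum>j\<le>m. norm (p j) * X)"
        by (rule sum_norm_le) (use term_le in auto)
      also have "\<dots> \<le> S * X"
        unfolding sum_distrib_right[symmetric] by (intro mult_right_mono sum_le X)
      also have "\<dots> \<le> b * A * X"
        using A \<open>b > 0\<close> X by (intro mult_right_mono) (auto simp: field_simps)
      finally have "b * real M powr s * norm (c M) \<le>
          b * real M powr s * (K * (A * A ^ m) * fact M powr - \<tau>)"
        by (simp add: X_def mult_ac)
      then have "norm (c M) \<le> K * (A * A ^ m) * fact M powr - \<tau>"
        by (rule mult_left_le_imp_le) (use \<open>b > 0\<close> \<open>M \<ge> 1\<close> in simp)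
      also have "\<dots> \<le> K * A ^ M * fact M powr - \<tau>"
      proof (intro mult_right_mono mult_left_mono)
        have "A ^ Suc m \<le> A ^ M"
          using A M \<open>n \<ge> 1\<close> by (intro power_increasing) auto
        then show "A * A ^ m \<le> A ^ M" by simp
      qed (use K in auto)
      finally show ?thesis .
    qed
  qed
  show thesis
    by (rule that[of K A]) (use K A bound in \<open>auto simp: \<tau>_def\<close>)
qed

text \<open>At m = k + d the term of lowest index is p_d c_k, because p vanishes beyond d. The
  remaining indices are written as k plus an offset, the form in which they are bounded
  later.\<close>

lemma recurrence_backward_le:
  fixes c p :: "nat \<Rightarrow> complex" and R :: "nat \<Rightarrow> real"
  assumes rec: "\<And>m. of_real (R m) * c (m + n) + (\<Sum>j\<le>m. p j * c (m - j)) = 0"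
    and p: "\<And>j. j > d \<Longrightarrow> p j = 0"
  shows "norm (p d) * norm (c k) \<le>
    \<bar>R (k + d)\<bar> * norm (c (k + (n + d))) + (\<Sum>j<d. norm (p j) * norm (c (k + (d - j))))"
proof -
  have p': "j \<le> d" if "p j \<noteq> 0" for j
    using p that not_le by blast
  have "(\<Sum>j\<le>k + d. p j * c (k + d - j)) = (\<Sum>j\<le>d. p j * c (k + d - j))"
    by (rule sum.mono_neutral_right) (auto dest: p')
  also have "\<dots> = p d * c k + (\<Sum>j<d. p j * c (k + (d - j)))"
    by (simp add: lessThan_Suc_atMost[symmetric])
  finally have "of_real (R (k + d)) * c (k + (n + d)) +
      (p d * c k + (\<Sum>j<d. p j * c (k + (d - j)))) = 0"
    using rec[of "k + d"] by (simp only: add.assoc add.commute[of d n])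
  moreover have "b = - a - y" if "a + (b + y) = 0" for a b y :: complex
    using that by algebra
  ultimately have "p d * c k =
      - (of_real (R (k + d)) * c (k + (n + d))) - (\<Sum>j<d. p j * c (k + (d - j)))"
    by blast
  then have "norm (p d * c k) \<le>
      norm (of_real (R (k + d)) * c (k + (n + d))) + norm (\<Sum>j<d. p j * c (k + (d - j)))"
    by (metis norm_triangle_ineq4 norm_minus_cancel)
  also have "norm (\<Sum>j<d. p j * c (k + (d - j))) \<le> (\<Sum>j<d. norm (p j) * norm (c (k + (d - j))))"
    by (rule sum_norm_le) (simp add: norm_mult)
  finally show ?thesis by (simp add: norm_mult)
qed

text \<open>Besides finishing the contradiction for the lower bound, this shows with
  \<open>k0 = 1\<close> that a nontrivial solution is not constant.\<close>

lemma recurrence_vanish_all: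
  fixes c p :: "nat \<Rightarrow> complex" and R :: "nat \<Rightarrow> real"
  assumes rec: "\<And>m. of_real (R m) * c (m + n) + (\<Sum>j\<le>m. p j * c (m - j)) = 0"
    and p: "\<And>j. j > d \<Longrightarrow> p j = 0" and "p d \<noteq> 0" "n \<ge> 1"
    and tail: "\<And>k. k \<ge> k0 \<Longrightarrow> c k = 0"
  shows "c k = 0"
proof -
  \<comment> \<open>Subtraction on naturals is truncated, so i = k0 covers every index.\<close>
  have "\<forall>k\<ge>k0 - i. c k = 0" for i
  proof (induction i)
    case (Suc i)
    show ?case
    proof safe
      fix k assume k: "k \<ge> k0 - Suc i"
      have "c (k + (n + d)) = 0" "\<And>j. j < d \<Longrightarrow> c (k + (d - j)) = 0"
        using Suc k \<open>n \<ge> 1\<close> by auto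
      then have "norm (p d) * norm (c k) \<le> 0"
        using recurrence_backward_le[where k = k and d = d and p = p and c = c and n = n and R = R, OF rec p] by simp
      with \<open>p d \<noteq> 0\<close> show "c k = 0"
        by (simp add: mult_le_0_iff)
    qed
  qed (use tail in simp)
  from this[of k0] show ?thesis by simp
qed

text \<open>The threshold \<open>k0\<close> from which a bound can be halved does not depend on the
  number N of halvings, because the backward recurrence at k uses only indices above k. Hence N may
  tend to infinity at a fixed index.\<close>

lemma recurrence_coeffs_lower:
  fixes c p :: "nat \<Rightarrow> complex" and R :: "nat \<Rightarrow> real"
  assumes rec: "\<And>m. of_real (R m) * c (m + n) + (\<Sum>j\<le>m. p j * c (m - j)) = 0"
    and p: "\<And>j. j > d \<Longrightarrow> p j = 0" and "p d \<noteq> 0" "n \<ge> 1"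
    and R: "\<And>m. \<bar>R m\<bar> \<le> B * real (m + 1) powr s"
    and "s > 0" "Q > 0" and \<tau>: "\<tau> * real (n + d) > s"
    and decay: "\<forall>\<^sub>F m in sequentially. norm (c m) \<le> Q ^ m * fact m powr - \<tau>"
  shows "c k = 0"
proof -
  have "B \<ge> 0"
    using R[of 0] by simp
  have "\<tau> > 0"
    using \<tau> \<open>s > 0\<close> by (smt (verit) mult_nonpos_nonneg of_nat_0_le_iff)
  define W where "W = (\<lambda>k. Q ^ k * fact k powr - \<tau>)"
  \<comment> \<open>\<open>e k\<close> is the right side of the backward recurrence after every
    coefficient is bounded by \<open>W\<close> and the factor \<open>W k\<close> is taken out. Its
    first summand is O(k^(s - \<tau> (n + d))), which is where the strict inequality on \<tau>
    enters; the others decay because \<tau> > 0 and d - j >= 1.\<close>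
  define e where "e = (\<lambda>k. B * real (k + d + 1) powr s * (Q ^ (n + d) * real (k + 1) powr (- \<tau> * real (n + d)))
      + (\<Sum>j<d. norm (p j) * (Q ^ (d - j) * real (k + 1) powr (- \<tau> * real (d - j)))))"
  have W_pos: "W k > 0" for k
    using \<open>Q > 0\<close> by (simp add: W_def)
  have W_add: "W (k + i) \<le> W k * (Q ^ i * real (k + 1) powr (- \<tau> * real i))" for k i
  proof -
    have "(real (k + 1) ^ i * fact k) powr \<tau> \<le> fact (k + i) powr \<tau>"
      using \<open>\<tau> > 0\<close> by (intro powr_mono2 power_mult_fact_le_fact) auto
    moreover have "(real (k + 1) ^ i * fact k) powr \<tau> = real (k + 1) powr (\<tau> * real i) * fact k powr \<tau>"
      by (simp add: powr_mult powr_powr powr_realpow[symmetric] mult.commute)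
    ultimately have "fact (k + i) powr - \<tau> \<le> real (k + 1) powr (- \<tau> * real i) * fact k powr - \<tau>"
      by (simp add: powr_minus field_simps)
    then have "Q ^ (k + i) * fact (k + i) powr - \<tau> \<le>
        Q ^ (k + i) * (real (k + 1) powr (- \<tau> * real i) * fact k powr - \<tau>)"
      using \<open>Q > 0\<close> by (intro mult_left_mono) auto
    then show ?thesis by (simp add: W_def power_add mult_ac)
  qed
  have "e \<longlonglongrightarrow> 0"
  proof -
    define t where "t = \<tau> * real (n + d)"
    have "(\<lambda>k. real (k + d + 1) powr s * real (k + 1) powr (- t)) \<longlonglongrightarrow> 0"
    proof -
      have "t > s" using \<tau> by (simp add: t_def)
      then show ?thesis using \<open>s > 0\<close> by real_asymp
    qed
    from tendsto_mult[OF tendsto_const[of "B * Q ^ (n + d)"] this]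
    have 1: "(\<lambda>k. B * real (k + d + 1) powr s * (Q ^ (n + d) * real (k + 1) powr (- \<tau> * real (n + d)))) \<longlonglongrightarrow> 0"
      by (simp add: t_def mult_ac)
    have 2: "(\<lambda>k. norm (p j) * (Q ^ (d - j) * real (k + 1) powr (- \<tau> * real (d - j)))) \<longlonglongrightarrow> 0"
      if "j < d" for j
    proof -
      define t where "t = \<tau> * real (d - j)"
      have "t > 0" using that \<open>\<tau> > 0\<close> by (simp add: t_def)
      then have "(\<lambda>k. real (k + 1) powr (- t)) \<longlonglongrightarrow> 0" by real_asymp
      from tendsto_mult[OF tendsto_const[of "norm (p j) * Q ^ (d - j)"] this]
      show ?thesis by (simp add: t_def mult_ac)
    qed
    have "(\<lambda>k. \<Sum>j<d. norm (p j) * (Q ^ (d - j) * real (k + 1) powr (- \<tau> * real (d - j)))) \<longlonglongrightarrow> 0"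
      by (rule tendsto_null_sum) (use 2 in auto)
    from tendsto_add[OF 1 this] show ?thesis
      by (simp add: e_def)
  qed
  then have "\<forall>\<^sub>F k in sequentially. e k < norm (p d) / 2"
    using \<open>p d \<noteq> 0\<close> by (intro order_tendstoD(2)) auto
  with decay have "\<forall>\<^sub>F k in sequentially. norm (c k) \<le> W k \<and> e k \<le> norm (p d) / 2"
    unfolding W_def by eventually_elim auto
  then obtain k0 where k0: "\<And>k. k \<ge> k0 \<Longrightarrow> norm (c k) \<le> W k" "\<And>k. k \<ge> k0 \<Longrightarrow> e k \<le> norm (p d) / 2"
    unfolding eventually_sequentially by blast
  \<comment> \<open>For large indices the backward recurrence halves any bound that is a multiple of \<open>W\<close>.\<close>
  have halve: "\<forall>k\<ge>k0. norm (c k) \<le> (1 / 2) ^ N * W k" for N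
  proof (induction N)
    case (Suc N)
    show ?case
    proof safe
      fix k assume k: "k \<ge> k0"
      let ?q = "\<lambda>i. Q ^ i * real (k + 1) powr (- \<tau> * real i)"
      have c: "norm (c (k + i)) \<le> (1 / 2) ^ N * W k * ?q i" for i
      proof -
        have "norm (c (k + i)) \<le> (1 / 2) ^ N * W (k + i)"
          using Suc k by auto
        also have "\<dots> \<le> (1 / 2) ^ N * (W k * ?q i)"
          by (intro mult_left_mono W_add) auto
        finally show ?thesis by (simp add: mult_ac)
      qed
      have "norm (p d) * norm (c k) \<le> \<bar>R (k + d)\<bar> * norm (c (k + (n + d)))
          + (\<Sum>j<d. norm (p j) * norm (c (k + (d - j))))"
        by (rule recurrence_backward_le[OF rec p])
      also have "\<dots> \<le> B * real (k + d + 1) powr s * ((1 / 2) ^ N * W k * ?q (n + d))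
          + (\<Sum>j<d. norm (p j) * ((1 / 2) ^ N * W k * ?q (d - j)))"
        using \<open>B \<ge> 0\<close> R[of "k + d"]
        by (intro add_mono mult_mono sum_mono c) auto
      also have "\<dots> = (1 / 2) ^ N * W k * e k"
        by (simp add: e_def sum_distrib_left distrib_left mult_ac)
      also have "\<dots> \<le> (1 / 2) ^ N * W k * (norm (p d) / 2)"
        using W_pos[of k] by (intro mult_left_mono k0 k) auto
      finally have "norm (p d) * norm (c k) \<le> norm (p d) * ((1 / 2) ^ Suc N * W k)"
        by (simp add: mult_ac)
      then show "norm (c k) \<le> (1 / 2) ^ Suc N * W k"
        by (rule mult_left_le_imp_le) (use \<open>p d \<noteq> 0\<close> in simp)
    qed
  qed (use k0 in simp)
  have "c k = 0" if "k \<ge> k0" for k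
  proof -
    have "(\<lambda>N. (1 / 2) ^ N * W k) \<longlonglongrightarrow> 0"
      by (intro tendsto_mult_left_zero LIMSEQ_realpow_zero) auto
    then have "norm (c k) \<le> 0"
      by (rule LIMSEQ_le_const) (use halve that in auto)
    then show ?thesis by simp
  qed
  from recurrence_vanish_all[where k = k, OF rec p \<open>p d \<noteq> 0\<close> \<open>n \<ge> 1\<close> this] show ?thesis .
qed

subsection \<open>Fractional calculus of series in powers of \<open>t powr \<alpha>\<close>\<close>

text \<open>As \<open>0 powr 0 = 0\<close>, the exponent 0 is treated separately to keep the value at the origin.\<close>

definition fpower :: "real \<Rightarrow> real \<Rightarrow> real" where
  "fpower s t = (if s = 0 then 1 else t powr s)"

text \<open>The functions t^s f(t^\<alpha>) contain the solution (s = 0). Fractional integration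
  (for s > 0) and differentiation (for s >= 1) only shift s and multiply the coefficients of f by
  Gamma quotients.\<close>

definition frac_series :: "real \<Rightarrow> real \<Rightarrow> (nat \<Rightarrow> complex) \<Rightarrow> real \<Rightarrow> complex" where
  "frac_series \<alpha> s a t = of_real (fpower s t) * entire_fun a (of_real (t powr \<alpha>))"

text \<open>At 0 the chain rule can fail, since \<open>powr\<close> with an exponent between 0 and 1
  is not differentiable there. Factoring out y reduces the one-sided derivative to a limit of the
  cofactor.\<close>

lemma has_vector_derivative_at_0_halfline:
  fixes f h :: "real \<Rightarrow> 'a::real_normed_vector"
  assumes "(h \<longlongrightarrow> l) (at 0 within {0..})" and f: "\<And>y. y \<ge> 0 \<Longrightarrow> f y = y *\<^sub>R h y"
  shows "(f has_vector_derivative l) (at 0 within {0..})"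
  unfolding has_vector_derivative_def has_derivative_within
proof
  have "((\<lambda>y. h y - l) \<longlongrightarrow> 0) (at 0 within {0..})"
    using assms(1) by (simp add: LIM_zero_iff)
  then show "((\<lambda>y. (1 / norm (y - 0)) *\<^sub>R (f y - (f 0 + (y - 0) *\<^sub>R l))) \<longlongrightarrow> 0) (at 0 within {0..})"
  proof (rule Lim_transform_eventually)
    show "\<forall>\<^sub>F y in at 0 within {0..}. h y - l = (1 / norm (y - 0)) *\<^sub>R (f y - (f 0 + (y - 0) *\<^sub>R l))"
      unfolding eventually_at_filter
      by (intro always_eventually) (auto simp: f scaleR_diff_right)
  qed
qed (rule bounded_linear_scaleR_left)

lemma frac_series_tendsto_0:
  assumes "\<alpha> > 0" "s \<ge> 0" "entire_coeffs a"
  shows "(frac_series \<alpha> s a \<longlongrightarrow> frac_series \<alpha> s a 0) (at 0 within {0..})"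
proof -
  have nonneg: "\<forall>\<^sub>F y in at 0 within {0..}. 0 \<le> (y :: real)"
    unfolding eventually_at_filter by (intro always_eventually) auto
  have powr: "((\<lambda>y. y powr r) \<longlongrightarrow> 0 powr r) (at 0 within {0..})" if "r > 0" for r :: real
    by (intro tendsto_powr2 tendsto_ident_at tendsto_const nonneg that)
  have "((\<lambda>y. fpower s y) \<longlongrightarrow> fpower s 0) (at 0 within {0..})"
    using powr[of s] assms(2) by (simp add: fpower_def)
  moreover have "((\<lambda>y. entire_fun a (of_real (y powr \<alpha>))) \<longlongrightarrow> entire_fun a (of_real (0 powr \<alpha>)))
      (at 0 within {0..})"
  proof (rule isCont_tendsto_compose[where g = "entire_fun a"])
    show "isCont (entire_fun a) (of_real (0 powr \<alpha>))"
      by (rule DERIV_isCont[OF entire_fun_has_field_derivative[OF assms(3)]])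
    show "((\<lambda>y. complex_of_real (y powr \<alpha>)) \<longlongrightarrow> of_real (0 powr \<alpha>)) (at 0 within {0..})"
      by (intro tendsto_of_real powr assms)
  qed
  ultimately show ?thesis
    unfolding frac_series_def by (intro tendsto_mult tendsto_of_real)
qed

lemma frac_series_has_vector_derivative:
  assumes "\<alpha> > 0" "s \<ge> 1" "t \<ge> 0" and a: "entire_coeffs a"
  shows "(frac_series \<alpha> s a has_vector_derivative
           frac_series \<alpha> (s - 1) (\<lambda>m. of_real (s + \<alpha> * real m) * a m) t) (at t within {0..})"
proof -
  have deriv: "frac_series \<alpha> (s - 1) (\<lambda>m. of_real (s + \<alpha> * real m) * a m) t =
      of_real (fpower (s - 1) t) * (of_real s * entire_fun a (of_real (t powr \<alpha>)) +
        of_real \<alpha> * of_real (t powr \<alpha>) * entire_fun (diffs a) (of_real (t powr \<alpha>)))" for t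
    using entire_fun_affine_mult(2)[OF a, of "of_real s" "of_real \<alpha>"] by (simp add: frac_series_def)
  show ?thesis
  proof (cases "t = 0")
    case True
    have "(frac_series \<alpha> s a has_vector_derivative frac_series \<alpha> (s - 1) a 0) (at 0 within {0..})"
    proof (rule has_vector_derivative_at_0_halfline)
      show "(frac_series \<alpha> (s - 1) a \<longlongrightarrow> frac_series \<alpha> (s - 1) a 0) (at 0 within {0..})"
        using assms by (intro frac_series_tendsto_0) auto
      show "frac_series \<alpha> s a y = y *\<^sub>R frac_series \<alpha> (s - 1) a y" if "y \<ge> 0" for y
      proof -
        have "fpower s y = y * fpower (s - 1) y"
          using that \<open>s \<ge> 1\<close> by (cases "y = 0") (auto simp: fpower_def powr_diff)
        then show ?thesis by (simp add: frac_series_def scaleR_conv_of_real)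
      qed
    qed
    \<comment> \<open>At the origin only m = 0 counts: its factor s + \<alpha> * 0 is 1 if s = 1,
      and for s > 1 both sides contain \<open>fpower (s - 1) 0 = 0\<close>.\<close>
    moreover have "frac_series \<alpha> (s - 1) a 0 = frac_series \<alpha> (s - 1) (\<lambda>m. of_real (s + \<alpha> * real m) * a m) 0"
      unfolding deriv by (simp add: frac_series_def fpower_def)
    ultimately show ?thesis using True by simp
  next
    case False
    with assms have t: "t > 0" by simp
    have 1: "((\<lambda>x. complex_of_real (x powr r)) has_vector_derivative of_real (r * t powr (r - 1))) (at t)" for r :: real
      using has_vector_derivative_of_real[OF has_real_derivative_powr[OF t, of r]] .
    have 2: "((\<lambda>x. entire_fun a (of_real (x powr \<alpha>))) has_vector_derivative
        of_real (\<alpha> * t powr (\<alpha> - 1)) * entire_fun (diffs a) (of_real (t powr \<alpha>))) (at t)"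
      using field_vector_diff_chain_at[OF 1 entire_fun_has_field_derivative[OF a]] by (simp add: o_def)
    have "(frac_series \<alpha> s a has_vector_derivative
        of_real (t powr s) * (of_real (\<alpha> * t powr (\<alpha> - 1)) * entire_fun (diffs a) (of_real (t powr \<alpha>)))
        + of_real (s * t powr (s - 1)) * entire_fun a (of_real (t powr \<alpha>))) (at t)"
      using has_vector_derivative_mult[OF 1[of s] 2] \<open>s \<ge> 1\<close> by (simp add: frac_series_def[abs_def] fpower_def)
    also have "of_real (t powr s) * (of_real (\<alpha> * t powr (\<alpha> - 1)) * entire_fun (diffs a) (of_real (t powr \<alpha>)))
        + of_real (s * t powr (s - 1)) * entire_fun a (of_real (t powr \<alpha>)) =
        frac_series \<alpha> (s - 1) (\<lambda>m. of_real (s + \<alpha> * real m) * a m) t"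
    proof -
      have eq: "fpower (s - 1) t = t powr s / t" "t powr (s - 1) = t powr s / t" "t powr (\<alpha> - 1) = t powr \<alpha> / t"
        using t by (auto simp: fpower_def powr_diff)
      then show ?thesis
        unfolding deriv eq using t by (simp add: algebra_simps add_divide_distrib)
    qed
    finally show ?thesis by (rule has_vector_derivative_at_within)
  qed
qed

text \<open>The constant K makes room for the term c_0 of the solution: what remains after splitting
  it off has exponent \<alpha>, and the first derivative removes it.\<close>

lemma halfline_deriv_frac_series:
  assumes "\<alpha> > 0" "s \<ge> 1" "entire_coeffs a" "t \<ge> 0"
    and \<phi>: "\<And>t. t \<ge> 0 \<Longrightarrow> \<phi> t = K + frac_series \<alpha> s a t"
  shows "halfline_deriv \<phi> t = frac_series \<alpha> (s - 1) (\<lambda>m. of_real (s + \<alpha> * real m) * a m) t"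
  unfolding halfline_deriv_def
proof (rule vector_derivative_within)
  have "t islimpt {t..t+1}" by simp
  then have "t islimpt {0..}" by (rule islimpt_subset) (use assms in auto)
  then show "at t within {0..} \<noteq> bot" by (simp add: trivial_limit_within)
  have "((\<lambda>t. K + frac_series \<alpha> s a t) has_vector_derivative
      0 + frac_series \<alpha> (s - 1) (\<lambda>m. of_real (s + \<alpha> * real m) * a m) t) (at t within {0..})"
    by (intro has_vector_derivative_add has_vector_derivative_const frac_series_has_vector_derivative assms)
  then show "(\<phi> has_vector_derivative frac_series \<alpha> (s - 1) (\<lambda>m. of_real (s + \<alpha> * real m) * a m) t)
      (at t within {0..})"
    by (intro has_vector_derivative_transform[where g = \<phi>, OF _ \<phi>]) (use assms in auto)
qed

text \<open>The factors from single derivatives telescope by Gamma (z + 1) = z Gamma z. The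
  condition k <= s lets each derivative start from an exponent of at least 1. It is used with k <
  \<alpha> = s for the initial values and with k = s = l for the outer derivatives.\<close>

lemma halfline_deriv_funpow_frac_series:
  assumes "\<alpha> > 0" "entire_coeffs a" "real k \<le> s"
    and \<phi>: "\<And>t. t \<ge> 0 \<Longrightarrow> \<phi> t = K + frac_series \<alpha> s a t"
  defines "b \<equiv> \<lambda>k m. of_real (Gamma (s + \<alpha> * real m + 1) / Gamma (s + \<alpha> * real m - real k + 1)) * a m"
  shows "entire_coeffs (b k) \<and>
    (\<forall>t\<ge>0. (halfline_deriv ^^ k) \<phi> t = (if k = 0 then K else 0) + frac_series \<alpha> (s - real k) (b k) t)"
  using \<open>real k \<le> s\<close>
proof (induction k)
  case 0
  have "s + \<alpha> * real m + 1 > 0" for m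
    using 0 \<open>\<alpha> > 0\<close> by (simp add: add_nonneg_pos)
  then have "Gamma (s + \<alpha> * real m + 1) \<noteq> 0" for m
    using Gamma_real_pos less_irrefl by metis
  then have "b 0 = a" by (simp add: b_def)
  then show ?case using \<phi> assms by simp
next
  case (Suc k)
  then have IH: "entire_coeffs (b k)"
    "\<And>t. t \<ge> 0 \<Longrightarrow> (halfline_deriv ^^ k) \<phi> t = (if k = 0 then K else 0) + frac_series \<alpha> (s - real k) (b k) t"
    by simp_all
  have b: "of_real (s - real k + \<alpha> * real m) * b k m = b (Suc k) m" for m
  proof -
    define z where "z = s - real k + \<alpha> * real m"
    have "\<alpha> * real m \<ge> 0" using \<open>\<alpha> > 0\<close> by simp
    then have "z \<ge> 1" using Suc.prems by (simp add: z_def)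
    then have "Gamma (z + 1) = z * Gamma z"
      by (intro Gamma_plus1) (auto elim!: nonpos_Ints_cases)
    moreover have eq: "s + \<alpha> * real m - real k + 1 = z + 1" "s + \<alpha> * real m - real (Suc k) + 1 = z"
      by (simp_all add: z_def)
    ultimately show ?thesis
      unfolding b_def z_def[symmetric] eq using \<open>z \<ge> 1\<close> by simp
  qed
  have "b (Suc k) = (\<lambda>m. (of_real (s - real k) + of_real \<alpha> * of_nat m) * b k m)"
    using b by (simp add: fun_eq_iff)
  then have "entire_coeffs (b (Suc k))"
    using entire_fun_affine_mult(1)[OF IH(1)] by simp
  moreover have "halfline_deriv ((halfline_deriv ^^ k) \<phi>) t = frac_series \<alpha> (s - real k - 1) (b (Suc k)) t"
    if "t \<ge> 0" for t
    using halfline_deriv_frac_series[OF \<open>\<alpha> > 0\<close> _ IH(1) that IH(2)] Suc.prems unfolding b by simp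
  ultimately show ?case by (simp add: algebra_simps)
qed

section \<open>Fractional integration and the Caputo derivative\<close>

lemma has_integral_RL_kernel_powr:
  fixes x \<beta> \<gamma> :: real
  assumes "x > 0" "\<beta> > 0" "\<gamma> > -1"
  shows "((\<lambda>t. (x - t) powr (\<beta> - 1) * t powr \<gamma>) has_integral
           Gamma \<beta> * Gamma (\<gamma> + 1) / Gamma (\<gamma> + \<beta> + 1) * x powr (\<gamma> + \<beta>)) {0..x}"
proof -
  \<comment> \<open>The substitution t = x u reduces the claim to the Beta integral; the power of x
    multiplied in afterwards undoes the scaling of the two factors.\<close>
  have "((\<lambda>t. t powr \<gamma> * (1 - t) powr (\<beta> - 1)) has_integral Beta (\<gamma> + 1) \<beta>) (cbox 0 1)"
    using has_integral_Beta_real[of "\<gamma> + 1" \<beta>] assms by simp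
  from has_integral_affinity'[OF this, of "1 / x" 0]
  have "((\<lambda>t. (t / x) powr \<gamma> * (1 - t / x) powr (\<beta> - 1)) has_integral x * Beta (\<gamma> + 1) \<beta>) {0..x}"
    using assms by simp
  then have "((\<lambda>t. x powr (\<gamma> + \<beta> - 1) * ((t / x) powr \<gamma> * (1 - t / x) powr (\<beta> - 1))) has_integral
      x powr (\<gamma> + \<beta> - 1) * (x * Beta (\<gamma> + 1) \<beta>)) {0..x}"
    by (rule has_integral_mult_right)
  also have "x powr (\<gamma> + \<beta> - 1) * (x * Beta (\<gamma> + 1) \<beta>) =
      Gamma \<beta> * Gamma (\<gamma> + 1) / Gamma (\<gamma> + \<beta> + 1) * x powr (\<gamma> + \<beta>)"
    using assms by (simp add: Beta_def powr_diff powr_add mult_ac add_ac)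
  finally show ?thesis
  proof (rule has_integral_eq[rotated])
    fix t assume "t \<in> {0..x}"
    then have "(1 - t / x) powr (\<beta> - 1) = (x - t) powr (\<beta> - 1) / x powr (\<beta> - 1)"
      "(t / x) powr \<gamma> = t powr \<gamma> / x powr \<gamma>"
      using assms by (simp_all add: powr_divide[symmetric] diff_divide_distrib)
    then show "x powr (\<gamma> + \<beta> - 1) * ((t / x) powr \<gamma> * (1 - t / x) powr (\<beta> - 1)) =
        (x - t) powr (\<beta> - 1) * t powr \<gamma>"
      using assms by (simp add: powr_add powr_diff)
  qed
qed

text \<open>Termwise integration is by dominated convergence: for t <= x every partial sum is at
  most the kernel times t^s times the full series of norms at x^\<alpha>, and this is integrable
  even when the kernel is singular at t = x. The new coefficients stay entire because the Gamma
  quotients are at most s^(-\<beta>) for \<beta> > 0.\<close>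

lemma RL_integral_frac_series:
  assumes "\<alpha> > 0" "s > 0" "\<beta> \<ge> 0" and a: "entire_coeffs a"
    and \<phi>: "\<And>t. t \<ge> 0 \<Longrightarrow> \<phi> t = frac_series \<alpha> s a t"
  defines "b \<equiv> \<lambda>m. of_real (Gamma (s + \<alpha> * real m + 1) / Gamma (s + \<alpha> * real m + \<beta> + 1)) * a m"
  shows "entire_coeffs b" and "x \<ge> 0 \<Longrightarrow> RL_integral \<beta> \<phi> x = frac_series \<alpha> (s + \<beta>) b x"
proof -
  have Gpos: "Gamma (s + \<alpha> * real m + r + 1) > 0" if "r \<ge> 0" for m r
    using that assms(1,2) by (intro Gamma_real_pos) (simp add: add_pos_nonneg)
  show b_entire: "entire_coeffs b"
  proof (cases "\<beta> = 0")
    case True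
    then show ?thesis using a Gpos[of 0] by (simp add: b_def less_imp_neq[THEN not_sym])
  next
    case False
    show ?thesis unfolding b_def
    proof (rule entire_coeffs_bounded_mult[OF a])
      fix m
      have am: "\<alpha> * real m \<ge> 0" using assms by simp
      have "s powr \<beta> \<le> (s + \<alpha> * real m + 1 - 1) powr \<beta>"
        using assms am by (intro powr_mono2) auto
      also have "\<dots> \<le> Gamma (s + \<alpha> * real m + 1 + \<beta>) / Gamma (s + \<alpha> * real m + 1)"
        using assms(2,3) am False by (intro Gamma_ratio_bounds(1)) linarith+
      finally have "s powr \<beta> \<le> Gamma (s + \<alpha> * real m + \<beta> + 1) / Gamma (s + \<alpha> * real m + 1)"
        by (simp add: add_ac)
      then have "Gamma (s + \<alpha> * real m + 1) / Gamma (s + \<alpha> * real m + \<beta> + 1) \<le> 1 / s powr \<beta>"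
        using Gpos[of 0 m] Gpos[of \<beta> m] assms by (simp add: field_simps)
      then show "norm (complex_of_real (Gamma (s + \<alpha> * real m + 1) / Gamma (s + \<alpha> * real m + \<beta> + 1))) \<le> 1 / s powr \<beta>"
        unfolding norm_of_real using Gpos[of 0 m] Gpos[of \<beta> m] assms by simp
    qed
  qed
  assume "x \<ge> 0"
  \<comment> \<open>For \<beta> = 0 the integral is the identity by definition. At x = 0 both sides
    vanish, since s + \<beta> > 0.\<close>
  consider "\<beta> = 0" | "\<beta> > 0" "x = 0" | "\<beta> > 0" "x > 0"
    using \<open>x \<ge> 0\<close> \<open>\<beta> \<ge> 0\<close> by linarith
  then show "RL_integral \<beta> \<phi> x = frac_series \<alpha> (s + \<beta>) b x"
  proof cases
    case 1
    then have "b = a" using Gpos[of 0] by (simp add: b_def less_imp_neq[THEN not_sym])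
    with 1 show ?thesis using \<phi> \<open>x \<ge> 0\<close> by (simp add: RL_integral_def)
  next
    case 2
    then show ?thesis using assms by (simp add: RL_integral_def frac_series_def fpower_def)
  next
    case 3
    define \<gamma> where "\<gamma> = (\<lambda>m. s + \<alpha> * real m)"
    define I where "I = (\<lambda>m. Gamma \<beta> * Gamma (\<gamma> m + 1) / Gamma (\<gamma> m + \<beta> + 1) * x powr (\<gamma> m + \<beta>))"
    define h where "h = (\<lambda>t. ((x - t) powr (\<beta> - 1) * t powr s) * (\<Sum>m. norm (a m * of_real (x powr \<alpha>) ^ m)))"
    have \<gamma>: "\<gamma> m > 0" for m using assms by (simp add: \<gamma>_def add_pos_nonneg)
    have powr_\<gamma>: "t powr \<gamma> m = t powr s * (t powr \<alpha>) ^ m" if "t \<ge> 0" for t m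
      using that assms by (cases "t = 0") (auto simp: \<gamma>_def powr_add powr_power mult.commute)
    have "((\<lambda>t. (x - t) powr (\<beta> - 1) *\<^sub>R \<phi> t) has_integral
        of_real (Gamma \<beta>) * frac_series \<alpha> (s + \<beta>) b x) {0..x}"
    proof (rule has_integral_dominated_convergence)
      show "((\<lambda>t. \<Sum>m<k. ((x - t) powr (\<beta> - 1) * t powr \<gamma> m) *\<^sub>R a m) has_integral (\<Sum>m<k. I m *\<^sub>R a m)) {0..x}" for k
        unfolding I_def
      proof (intro has_integral_sum has_integral_scaleR_left has_integral_RL_kernel_powr 3)
        show "\<gamma> m > -1" for m using \<gamma>[of m] by simp
      qed simp
      show "h integrable_on {0..x}"
        unfolding h_def
        using has_integral_mult_left[OF has_integral_RL_kernel_powr[of x \<beta> s]] 3 assms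
        by (intro has_integral_integrable) auto
      show "\<forall>t\<in>{0..x}. norm (\<Sum>m<k. ((x - t) powr (\<beta> - 1) * t powr \<gamma> m) *\<^sub>R a m) \<le> h t" for k
      proof
        fix t assume t: "t \<in> {0..x}"
        have "norm (\<Sum>m<k. ((x - t) powr (\<beta> - 1) * t powr \<gamma> m) *\<^sub>R a m) \<le>
            (\<Sum>m<k. (x - t) powr (\<beta> - 1) * t powr s * norm (a m * of_real (x powr \<alpha>) ^ m))"
        proof (rule sum_norm_le)
          fix m
          have "(t powr \<alpha>) ^ m \<le> (x powr \<alpha>) ^ m"
            using t assms by (intro power_mono powr_mono2) auto
          then have "(x - t) powr (\<beta> - 1) * (t powr s * (t powr \<alpha>) ^ m) * norm (a m) \<le>
              (x - t) powr (\<beta> - 1) * (t powr s * (x powr \<alpha>) ^ m) * norm (a m)"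
            by (intro mult_right_mono mult_left_mono) auto
          then show "norm (((x - t) powr (\<beta> - 1) * t powr \<gamma> m) *\<^sub>R a m) \<le>
              (x - t) powr (\<beta> - 1) * t powr s * norm (a m * of_real (x powr \<alpha>) ^ m)"
            using t by (simp add: powr_\<gamma> norm_mult norm_power mult_ac)
        qed
        also have "\<dots> = (x - t) powr (\<beta> - 1) * t powr s * (\<Sum>m<k. norm (a m * of_real (x powr \<alpha>) ^ m))"
          by (simp add: sum_distrib_left)
        also have "\<dots> \<le> h t"
          unfolding h_def
          by (intro mult_left_mono sum_le_suminf entire_coeffs_norm_summable a) auto
        finally show "norm (\<Sum>m<k. ((x - t) powr (\<beta> - 1) * t powr \<gamma> m) *\<^sub>R a m) \<le> h t" .
      qed
      show "\<forall>t\<in>{0..x}. (\<lambda>k. \<Sum>m<k. ((x - t) powr (\<beta> - 1) * t powr \<gamma> m) *\<^sub>R a m)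
          \<longlonglongrightarrow> (x - t) powr (\<beta> - 1) *\<^sub>R \<phi> t"
      proof
        fix t assume t: "t \<in> {0..x}"
        have "(\<lambda>m. of_real ((x - t) powr (\<beta> - 1) * t powr s) * (a m * of_real (t powr \<alpha>) ^ m)) sums
            (of_real ((x - t) powr (\<beta> - 1) * t powr s) * entire_fun a (of_real (t powr \<alpha>)))"
          by (intro sums_mult entire_fun_sums a)
        moreover have "of_real ((x - t) powr (\<beta> - 1) * t powr s) * (a m * of_real (t powr \<alpha>) ^ m) =
            ((x - t) powr (\<beta> - 1) * t powr \<gamma> m) *\<^sub>R a m" for m
          using t by (simp add: powr_\<gamma> scaleR_conv_of_real mult_ac)
        moreover have "of_real ((x - t) powr (\<beta> - 1) * t powr s) * entire_fun a (of_real (t powr \<alpha>)) =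
            (x - t) powr (\<beta> - 1) *\<^sub>R \<phi> t"
          using t \<phi>[of t] \<open>s > 0\<close> by (simp add: frac_series_def fpower_def scaleR_conv_of_real)
        ultimately show "(\<lambda>k. \<Sum>m<k. ((x - t) powr (\<beta> - 1) * t powr \<gamma> m) *\<^sub>R a m)
            \<longlonglongrightarrow> (x - t) powr (\<beta> - 1) *\<^sub>R \<phi> t"
          by (simp add: sums_def)
      qed
      have "(\<lambda>m. of_real (Gamma \<beta>) * (of_real (x powr (s + \<beta>)) * (b m * of_real (x powr \<alpha>) ^ m))) sums
          (of_real (Gamma \<beta>) * (of_real (x powr (s + \<beta>)) * entire_fun b (of_real (x powr \<alpha>))))"
        by (intro sums_mult entire_fun_sums b_entire)
      moreover have "of_real (Gamma \<beta>) * (of_real (x powr (s + \<beta>)) * (b m * of_real (x powr \<alpha>) ^ m)) = I m *\<^sub>R a m" for m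
        using \<open>x \<ge> 0\<close> unfolding I_def powr_add[of x "\<gamma> m" \<beta>] powr_add[of x s \<beta>] powr_\<gamma>[OF \<open>x \<ge> 0\<close>]
        by (simp add: b_def \<gamma>_def scaleR_conv_of_real mult_ac)
      moreover have "of_real (x powr (s + \<beta>)) * entire_fun b (of_real (x powr \<alpha>)) = frac_series \<alpha> (s + \<beta>) b x"
        using 3 \<open>s > 0\<close> by (simp add: frac_series_def fpower_def)
      ultimately show "(\<lambda>k. \<Sum>m<k. I m *\<^sub>R a m) \<longlonglongrightarrow> of_real (Gamma \<beta>) * frac_series \<alpha> (s + \<beta>) b x"
        by (simp add: sums_def)
    qed
    moreover have "Gamma \<beta> \<noteq> 0"
      using Gamma_real_pos[OF 3(1)] by linarith
    ultimately show ?thesis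
      using 3 by (simp add: RL_integral_def integral_unique scaleR_conv_of_real)
  qed
qed

text \<open>For 0 < k < l the exponent \<alpha> - k is positive, so the k-th derivative vanishes at
  0 and the Taylor polynomial is just c_0. The rest has exponent \<alpha>; integration of order l -
  \<alpha> raises it to l and l derivatives lower it to 0, while Gamma (l + \<alpha> m + 1) cancels.
  Hypothesis and conclusion concern t >= 0 only, so the lemma can be iterated.\<close>

lemma caputo_deriv_frac_series:
  assumes "\<alpha> > 0" and c: "entire_coeffs c"
    and \<phi>: "\<And>t. t \<ge> 0 \<Longrightarrow> \<phi> t = frac_series \<alpha> 0 c t"
  defines "b \<equiv> \<lambda>m. of_real (Gamma (\<alpha> * real (Suc m) + 1) / Gamma (\<alpha> * real m + 1)) * c (Suc m)"
  shows "entire_coeffs b" and "t \<ge> 0 \<Longrightarrow> caputo_deriv \<alpha> \<phi> t = frac_series \<alpha> 0 b t"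
proof -
  define l where "l = nat \<lceil>\<alpha>\<rceil>"
  have l: "\<alpha> \<le> real l" "real l < \<alpha> + 1"
    unfolding l_def using \<open>\<alpha> > 0\<close> by linarith+
  then have "l \<ge> 1" using \<open>\<alpha> > 0\<close> by (cases l) auto
  define a where "a = (\<lambda>m. c (Suc m))"
  have a: "entire_coeffs a"
    unfolding a_def by (rule entire_coeffs_Suc[OF c])
  have \<phi>': "\<phi> t = c 0 + frac_series \<alpha> \<alpha> a t" if "t \<ge> 0" for t
    using \<phi>[OF that] \<open>\<alpha> > 0\<close> entire_coeffs_Suc(2)[OF c, of "of_real (t powr \<alpha>)"]
    by (simp add: frac_series_def fpower_def a_def)
  have init: "(halfline_deriv ^^ k) \<phi> 0 = (if k = 0 then c 0 else 0)" if "k < l" for k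
  proof -
    have "real k \<le> real l - 1" using that by linarith
    then have k: "real k < \<alpha>" using l by linarith
    then have "fpower (\<alpha> - real k) 0 = 0" by (simp add: fpower_def)
    then show ?thesis
      using halfline_deriv_funpow_frac_series[OF \<open>\<alpha> > 0\<close> a less_imp_le[OF k] \<phi>']
      by (simp add: frac_series_def)
  qed
  have taylor: "(\<Sum>k<l. (halfline_deriv ^^ k) \<phi> 0 / fact k * complex_of_real x ^ k) = c 0" for x
  proof -
    have "(\<Sum>k<l. (halfline_deriv ^^ k) \<phi> 0 / fact k * complex_of_real x ^ k) =
        (\<Sum>k\<in>{0}. (halfline_deriv ^^ k) \<phi> 0 / fact k * complex_of_real x ^ k)"
      using \<open>l \<ge> 1\<close> init by (intro sum.mono_neutral_right) auto
    then show ?thesis using init[of 0] \<open>l \<ge> 1\<close> by simp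
  qed
  define \<psi> where "\<psi> = (\<lambda>x. \<phi> x - (\<Sum>k<l. (halfline_deriv ^^ k) \<phi> 0 / fact k * complex_of_real x ^ k))"
  have \<psi>: "\<psi> t = frac_series \<alpha> \<alpha> a t" if "t \<ge> 0" for t
    using \<phi>'[OF that] unfolding \<psi>_def taylor by simp
  define \<beta> where "\<beta> = real l - \<alpha>"
  have \<beta>: "\<beta> \<ge> 0" "\<alpha> + \<beta> = real l" using l by (simp_all add: \<beta>_def)
  define b1 where "b1 = (\<lambda>m. of_real (Gamma (\<alpha> + \<alpha> * real m + 1) / Gamma (\<alpha> + \<alpha> * real m + \<beta> + 1)) * a m)"
  have b1: "entire_coeffs b1"
    unfolding b1_def by (rule RL_integral_frac_series(1)[OF \<open>\<alpha> > 0\<close> \<open>\<alpha> > 0\<close> \<beta>(1) a \<psi>])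
  have RL: "RL_integral \<beta> \<psi> t = 0 + frac_series \<alpha> (real l) b1 t" if "t \<ge> 0" for t
    using RL_integral_frac_series(2)[OF \<open>\<alpha> > 0\<close> \<open>\<alpha> > 0\<close> \<beta>(1) a \<psi> that] \<beta>(2) by (simp add: b1_def)
  have b: "of_real (Gamma (real l + \<alpha> * real m + 1) / Gamma (real l + \<alpha> * real m - real l + 1)) * b1 m = b m" for m
  proof -
    have eq: "\<alpha> + \<alpha> * real m + \<beta> + 1 = real l + \<alpha> * real m + 1"
      "\<alpha> + \<alpha> * real m + 1 = \<alpha> * real (Suc m) + 1" "real l + \<alpha> * real m - real l + 1 = \<alpha> * real m + 1"
      using \<beta> by (simp_all add: algebra_simps)
    have "Gamma (real l + \<alpha> * real m + 1) > 0"
      using \<open>\<alpha> > 0\<close> by (intro Gamma_real_pos) (simp add: add_nonneg_pos)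
    then show ?thesis unfolding b_def b1_def a_def eq by simp
  qed
  from halfline_deriv_funpow_frac_series[OF \<open>\<alpha> > 0\<close> b1 order_refl RL, unfolded b] \<open>l \<ge> 1\<close>
  have "entire_coeffs b \<and> (\<forall>t\<ge>0. (halfline_deriv ^^ l) (RL_integral \<beta> \<psi>) t = frac_series \<alpha> 0 b t)"
    by simp
  moreover have "caputo_deriv \<alpha> \<phi> = (halfline_deriv ^^ l) (RL_integral \<beta> \<psi>)"
    by (simp add: caputo_deriv_def RL_deriv_def Let_def l_def \<psi>_def \<beta>_def)
  ultimately show "entire_coeffs b" "t \<ge> 0 \<Longrightarrow> caputo_deriv \<alpha> \<phi> t = frac_series \<alpha> 0 b t"
    by auto
qed

lemma caputo_deriv_funpow_frac_series:
  assumes "\<alpha> > 0" and c: "entire_coeffs c"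
    and \<phi>: "\<And>t. t \<ge> 0 \<Longrightarrow> \<phi> t = frac_series \<alpha> 0 c t"
  defines "b \<equiv> \<lambda>n m. of_real (Gamma (\<alpha> * real (m + n) + 1) / Gamma (\<alpha> * real m + 1)) * c (m + n)"
  shows "entire_coeffs (b n) \<and> (\<forall>t\<ge>0. (caputo_deriv \<alpha> ^^ n) \<phi> t = frac_series \<alpha> 0 (b n) t)"
proof (induction n)
  case 0
  have "Gamma (\<alpha> * real m + 1) > 0" for m
    using \<open>\<alpha> > 0\<close> by (intro Gamma_real_pos) (simp add: add_nonneg_pos)
  then have "b 0 = c" by (simp add: b_def less_imp_neq[THEN not_sym])
  then show ?case using c \<phi> by simp
next
  case (Suc n)
  then have IH: "entire_coeffs (b n)" "\<And>t. t \<ge> 0 \<Longrightarrow> (caputo_deriv \<alpha> ^^ n) \<phi> t = frac_series \<alpha> 0 (b n) t"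
    by simp_all
  have "of_real (Gamma (\<alpha> * real (Suc m) + 1) / Gamma (\<alpha> * real m + 1)) * b n (Suc m) = b (Suc n) m" for m
  proof -
    have "Gamma (\<alpha> * real (Suc m) + 1) > 0"
      using \<open>\<alpha> > 0\<close> by (intro Gamma_real_pos) (simp add: add_nonneg_pos)
    then show ?thesis unfolding b_def by simp
  qed
  from caputo_deriv_frac_series[OF \<open>\<alpha> > 0\<close> IH, unfolded this] show ?case
    by simp
qed

subsection \<open>The order of solutions\<close>

lemma entire_fun_mult:
  assumes "entire_coeffs a" "entire_coeffs b"
  shows "entire_coeffs (\<lambda>m. \<Sum>j\<le>m. a j * b (m - j))"
    and "entire_fun (\<lambda>m. \<Sum>j\<le>m. a j * b (m - j)) z = entire_fun a z * entire_fun b z"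
proof -
  have sums: "(\<lambda>m. (\<Sum>j\<le>m. a j * b (m - j)) * z ^ m) sums (entire_fun a z * entire_fun b z)" for z
  proof -
    have "(\<lambda>m. \<Sum>j\<le>m. (a j * z ^ j) * (b (m - j) * z ^ (m - j))) sums (entire_fun a z * entire_fun b z)"
      unfolding entire_fun_def by (intro Cauchy_product_sums entire_coeffs_norm_summable assms)
    moreover have "(\<Sum>j\<le>m. (a j * z ^ j) * (b (m - j) * z ^ (m - j))) = (\<Sum>j\<le>m. a j * b (m - j)) * z ^ m" for m
      unfolding sum_distrib_right
    proof (rule sum.cong)
      fix j assume "j \<in> {..m}"
      then have "z ^ m = z ^ j * z ^ (m - j)" by (simp flip: power_add)
      then show "(a j * z ^ j) * (b (m - j) * z ^ (m - j)) = a j * b (m - j) * z ^ m" by simp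
    qed simp
    ultimately show ?thesis by simp
  qed
  show "entire_coeffs (\<lambda>m. \<Sum>j\<le>m. a j * b (m - j))"
    unfolding entire_coeffs_def using sums_summable[OF sums] by simp
  show "entire_fun (\<lambda>m. \<Sum>j\<le>m. a j * b (m - j)) z = entire_fun a z * entire_fun b z"
    using sums_unique[OF sums] unfolding entire_fun_def[of "\<lambda>m. \<Sum>j\<le>m. a j * b (m - j)"] by simp
qed

lemma entire_fun_add:
  assumes "entire_coeffs a" "entire_coeffs b"
  shows "entire_coeffs (\<lambda>m. a m + b m)"
    and "entire_fun (\<lambda>m. a m + b m) z = entire_fun a z + entire_fun b z"
proof -
  have sums: "(\<lambda>m. (a m + b m) * z ^ m) sums (entire_fun a z + entire_fun b z)" for z
    using sums_add[OF entire_fun_sums[OF assms(1), of z] entire_fun_sums[OF assms(2), of z]]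
    by (simp add: distrib_right)
  show "entire_coeffs (\<lambda>m. a m + b m)"
    unfolding entire_coeffs_def using sums_summable[OF sums] by simp
  show "entire_fun (\<lambda>m. a m + b m) z = entire_fun a z + entire_fun b z"
    using sums_unique[OF sums] unfolding entire_fun_def[of "\<lambda>m. a m + b m"] by simp
qed

lemma entire_fun_coeff_poly:
  shows "entire_coeffs (coeff P)" and "entire_fun (coeff P) z = poly P z"
proof -
  have sums: "(\<lambda>m. coeff P m * z ^ m) sums poly P z" for z
    unfolding poly_altdef by (rule sums_finite) (auto simp: coeff_eq_0 not_le)
  show "entire_coeffs (coeff P)"
    unfolding entire_coeffs_def using sums_summable[OF sums] by simp
  show "entire_fun (coeff P) z = poly P z"
    using sums_unique[OF sums] unfolding entire_fun_def by simp
qed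

text \<open>The Gamma estimates at x = \<alpha> m + 1 require x > 1 and so exclude m = 0; the
  minimum and maximum with R 0 in the constants \<open>b\<close> and \<open>B\<close> take care of
  that index.\<close>

lemma Gamma_step_ratio_bounds:
  fixes \<alpha> :: real and n :: nat
  assumes "\<alpha> > 0" "n \<ge> 1"
  defines "R \<equiv> \<lambda>m. Gamma (\<alpha> * real (m + n) + 1) / Gamma (\<alpha> * real m + 1)"
  obtains b B where "b > 0" "\<And>m. R m \<ge> b * real (m + n) powr (real n * \<alpha>)"
    "\<And>m. \<bar>R m\<bar> \<le> B * real (m + 1) powr (real n * \<alpha>)"
proof -
  define s where "s = real n * \<alpha>"
  have s: "s > 0" using assms by (simp add: s_def)
  have pos: "Gamma (\<alpha> * real m + 1) > 0" for m
    using \<open>\<alpha> > 0\<close> by (intro Gamma_real_pos) (simp add: add_nonneg_pos)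
  have R_pos: "R m > 0" for m
    unfolding R_def by (intro divide_pos_pos pos)
  have R_eq: "R m = Gamma (\<alpha> * real m + 1 + s) / Gamma (\<alpha> * real m + 1)" for m
    by (simp add: R_def s_def algebra_simps)
  define b where "b = min ((\<alpha> / (real n + 1)) powr s) (R 0 / real n powr s)"
  define B where "B = max ((\<alpha> + 1 + s) powr s) (R 0)"
  have lower: "R m \<ge> b * real (m + n) powr s" for m
  proof (cases "m = 0")
    case True
    have "b * real n powr s \<le> R 0 / real n powr s * real n powr s"
      unfolding b_def by (intro mult_right_mono) auto
    with True \<open>n \<ge> 1\<close> show ?thesis by simp
  next
    case False
    have "b * real (m + n) powr s \<le> (\<alpha> / (real n + 1)) powr s * real (m + n) powr s"
      unfolding b_def by (intro mult_right_mono) auto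
    also have "\<dots> = (\<alpha> / (real n + 1) * real (m + n)) powr s"
      using \<open>\<alpha> > 0\<close> by (subst powr_mult) auto
    also have "\<dots> \<le> (\<alpha> * real m + 1 - 1) powr s"
    proof (intro powr_mono2)
      \<comment> \<open>Valid for m >= 1; it replaces the base m given by the Gamma estimate by m +
        n, the index of the coefficient that R m multiplies.\<close>
      have "m + n \<le> m * (n + 1)" using False by (cases m) auto
      then have "real (m + n) \<le> real (m * (n + 1))" by (rule of_nat_mono)
      then have "real (m + n) \<le> real m * (real n + 1)" by (simp add: algebra_simps)
      then have "real (m + n) / (real n + 1) \<le> real m" by (simp add: field_simps)
      from mult_left_mono[OF this, of \<alpha>] \<open>\<alpha> > 0\<close>
      show "\<alpha> / (real n + 1) * real (m + n) \<le> \<alpha> * real m + 1 - 1" by simp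
    qed (use s \<open>\<alpha> > 0\<close> in auto)
    also have "\<dots> \<le> R m"
      unfolding R_eq using False s \<open>\<alpha> > 0\<close> by (intro Gamma_ratio_bounds) auto
    finally show ?thesis .
  qed
  have upper: "\<bar>R m\<bar> \<le> B * real (m + 1) powr s" for m
  proof (cases "m = 0")
    case True
    then show ?thesis using R_pos[of 0] by (simp add: B_def)
  next
    case False
    have "R m \<le> (\<alpha> * real m + 1 + s) powr s"
      unfolding R_eq using False s \<open>\<alpha> > 0\<close> by (intro Gamma_ratio_bounds) auto
    also have "\<dots> \<le> ((\<alpha> + 1 + s) * real (m + 1)) powr s"
      using s \<open>\<alpha> > 0\<close> by (intro powr_mono2) (auto simp: algebra_simps)
    also have "\<dots> = (\<alpha> + 1 + s) powr s * real (m + 1) powr s"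
      using s \<open>\<alpha> > 0\<close> by (subst powr_mult) auto
    also have "\<dots> \<le> B * real (m + 1) powr s"
      unfolding B_def by (intro mult_right_mono) auto
    finally show ?thesis using R_pos[of m] by simp
  qed
  show thesis
  proof (rule that[of b B])
    show "b > 0" using R_pos[of 0] \<open>\<alpha> > 0\<close> \<open>n \<ge> 1\<close> by (simp add: b_def)
  qed (use lower upper in \<open>simp_all add: s_def\<close>)
qed

theorem mainTheorem5:
  fixes \<alpha> :: real and n :: nat and P :: "complex poly" and y :: "real \<Rightarrow> complex"
  assumes "\<alpha> > 0" and "n \<ge> 1" and "P \<noteq> 0"
    and "alpha_analytic \<alpha> y"
    and "\<exists>t\<ge>0. y t \<noteq> 0"
    and "\<forall>x\<ge>0. (caputo_deriv \<alpha> ^^ n) y x + poly P (complex_of_real (x powr \<alpha>)) * y x = 0"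
  shows "\<exists>f. f holomorphic_on UNIV \<and>
             (\<forall>t\<ge>0. y t = f (complex_of_real (t powr \<alpha>))) \<and>
             entire_order f = ereal (1 / \<alpha> * (1 + real (degree P) / real n))"
proof -
  obtain c where y: "\<And>t. t \<ge> 0 \<Longrightarrow> (\<lambda>m. c m * complex_of_real ((t powr \<alpha>) ^ m)) sums y t"
    using assms(4) unfolding alpha_analytic_def by blast
  \<comment> \<open>The map from t to t^\<alpha> is onto [0, oo), so convergence and the equation,
    given in t, reach every real r >= 0.\<close>
  have root: "(r powr (1 / \<alpha>)) powr \<alpha> = r" if "r \<ge> 0" for r
    using that \<open>\<alpha> > 0\<close> by (simp add: powr_powr)
  have c: "entire_coeffs c"
  proof (rule entire_coeffs_of_real_nonneg)
    fix r :: real assume "r \<ge> 0"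
    with y[of "r powr (1 / \<alpha>)"] show "summable (\<lambda>m. c m * complex_of_real r ^ m)"
      by (simp add: root sums_summable)
  qed
  have y_eq: "y t = entire_fun c (of_real (t powr \<alpha>))" if "t \<ge> 0" for t
    using sums_unique2[OF y[OF that]] entire_fun_sums[OF c] by simp
  define p where "p = coeff P"
  define d where "d = degree P"
  have p: "p j = 0" if "j > d" for j using that by (simp add: p_def d_def coeff_eq_0)
  have pd: "p d \<noteq> 0" using \<open>P \<noteq> 0\<close> by (simp add: p_def d_def)
  define R where "R = (\<lambda>m. Gamma (\<alpha> * real (m + n) + 1) / Gamma (\<alpha> * real m + 1))"
  have "y t = frac_series \<alpha> 0 c t" if "t \<ge> 0" for t
    using y_eq[OF that] by (simp add: frac_series_def fpower_def)
  from caputo_deriv_funpow_frac_series[where n = n, OF \<open>\<alpha> > 0\<close> c this]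
  have D: "entire_coeffs (\<lambda>m. of_real (R m) * c (m + n))"
    "\<And>t. t \<ge> 0 \<Longrightarrow> (caputo_deriv \<alpha> ^^ n) y t = entire_fun (\<lambda>m. of_real (R m) * c (m + n)) (of_real (t powr \<alpha>))"
    by (simp_all add: R_def frac_series_def fpower_def)
  note prod = entire_fun_mult[OF entire_fun_coeff_poly(1)[of P] c]
  have rec: "of_real (R m) * c (m + n) + (\<Sum>j\<le>m. p j * c (m - j)) = 0" for m
  proof (rule entire_coeffs_unique)
    show "entire_coeffs (\<lambda>m. of_real (R m) * c (m + n) + (\<Sum>j\<le>m. p j * c (m - j)))"
      unfolding p_def by (rule entire_fun_add[OF D(1) prod(1)])
    show "entire_fun (\<lambda>m. of_real (R m) * c (m + n) + (\<Sum>j\<le>m. p j * c (m - j))) (of_real x) = 0"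
      if "x \<ge> 0" for x
      using assms(6)[rule_format, of "x powr (1 / \<alpha>)"] that
      unfolding p_def entire_fun_add(2)[OF D(1) prod(1)] prod(2) entire_fun_coeff_poly(2)
      by (simp add: D(2) y_eq root)
  qed
  define s where "s = real n * \<alpha>"
  have "s > 0" using assms by (simp add: s_def)
  obtain b B where b: "b > 0" "\<And>m. R m \<ge> b * real (m + n) powr s"
    and B: "\<And>m. \<bar>R m\<bar> \<le> B * real (m + 1) powr s"
    using Gamma_step_ratio_bounds[OF \<open>\<alpha> > 0\<close> \<open>n \<ge> 1\<close>] unfolding R_def s_def by blast
  define \<rho> where "\<rho> = real (n + d) / s"
  have "\<rho> > 0" using \<open>s > 0\<close> \<open>n \<ge> 1\<close> by (simp add: \<rho>_def)
  have nontrivial: "\<not> (\<forall>k. c k = 0)"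
  proof
    assume "\<forall>k. c k = 0"
    then have "entire_fun c z = 0" for z by (simp add: entire_fun_def)
    with assms(5) y_eq show False by auto
  qed
  \<comment> \<open>A nonzero coefficient of positive index forces the maximum modulus above e for
    large r, by Cauchy's inequality. Were all of them zero, the recurrence would make c_0 vanish as
    well.\<close>
  obtain m where m: "m \<ge> 1" "c m \<noteq> 0"
    using nontrivial recurrence_vanish_all[of R c n p d 1, OF rec p pd \<open>n \<ge> 1\<close>] by blast
  have "entire_order (entire_fun c) \<le> ereal \<rho>"
  proof -
    obtain K A where KA: "K > 0" "A > 0" "\<And>m. norm (c m) \<le> K * A ^ m * fact m powr (- s / real (n + d))"
      using recurrence_coeffs_upper[of R c n p d b s, OF rec p b(2) b(1) \<open>s > 0\<close> \<open>n \<ge> 1\<close>] by blast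
    have "filterlim (\<lambda>r. norm (c m) * r ^ m) at_top at_top"
      using m by (intro filterlim_tendsto_pos_mult_at_top[OF tendsto_const] filterlim_pow_at_top filterlim_ident) auto
    then have "\<forall>\<^sub>F r in at_top. norm (c m) * r ^ m > exp 1"
      by (simp add: filterlim_at_top_dense)
    then have large: "\<forall>\<^sub>F r in at_top. max_modulus (entire_fun c) r > exp 1"
      using eventually_gt_at_top[of 0]
      by eventually_elim (use entire_coeff_le_max_modulus[OF c] less_le_trans in blast)
    have "- s / real (n + d) = - 1 / \<rho>" by (simp add: \<rho>_def)
    with KA have growth: "norm (entire_fun c z) \<le> 2 * K * exp ((2 * A) powr \<rho> / \<rho> * norm z powr \<rho>)" if "z \<noteq> 0" for z
      using that \<open>\<rho> > 0\<close> by (intro entire_fun_growth_le[OF c]) auto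
    show ?thesis
      by (rule entire_order_leI[OF \<open>\<rho> > 0\<close> _ _ growth large]) (use KA \<open>\<rho> > 0\<close> in auto)
  qed
  moreover have "\<not> entire_order (entire_fun c) < ereal \<rho>"
  proof
    assume "entire_order (entire_fun c) < ereal \<rho>"
    then obtain \<sigma> where \<sigma>: "0 < \<sigma>" "\<sigma> < \<rho>"
      and le: "\<forall>\<^sub>F r in at_top. max_modulus (entire_fun c) r \<le> exp (r powr \<sigma>)"
      using entire_order_lessD \<open>\<rho> > 0\<close> by blast
    have decay: "\<forall>\<^sub>F m in sequentially. norm (c m) \<le> exp 1 ^ m * fact m powr - (1 / \<sigma>)"
      using entire_coeffs_decay[OF c \<sigma>(1) le] by simp
    \<comment> \<open>This is \<sigma> < \<rho> rewritten, because (n + d) / \<rho> = s.\<close>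
    have "1 / \<sigma> * real (n + d) > s"
      using \<sigma> \<open>s > 0\<close> by (simp add: \<rho>_def field_simps)
    from recurrence_coeffs_lower[of R c n p d B s "exp 1" "1 / \<sigma>",
        OF rec p pd \<open>n \<ge> 1\<close> B \<open>s > 0\<close> exp_gt_zero this decay] nontrivial
    show False by blast
  qed
  ultimately have "entire_order (entire_fun c) = ereal \<rho>" by simp
  also have "\<rho> = 1 / \<alpha> * (1 + real (degree P) / real n)"
    using assms by (simp add: \<rho>_def s_def d_def field_simps)
  finally show ?thesis
    using entire_fun_holomorphic[OF c] y_eq by blast
qed

end
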